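(* Let $(\hat\nu_k,\hat\nu_{k^+})_{k\ge1}$ be stochastic sequences of measures in $\mathcal M_+(\mathcal X)$, adapted to filtrations $(\mathfrak F_k)_k,(\mathfrak F_k^+)_k$ as in the context, satisfying the assumptions $(\hat{\mathcal H}_D)$, $(\hat{\mathcal H}^+_{\varepsilon,a})$ with $a\ge\frac{d}{2(2+d)}$, $(\hat{\mathcal H}^{\mathrm{smooth},1}_\varepsilon)$, $(\hat{\mathcal H}^{\mathrm{smooth},2}_\varepsilon)$ and $(\hat{\mathcal H}^\infty_{\mathrm{TV}})$ listed in the context, with the iteration-dependent schedules $$m_k=k\vee1,\qquad \varepsilon_k=\min\left(\alpha,\frac{1}{\sqrt{k\vee1}}\right),\qquad \beta_k=\frac{1}{k\vee 1},$$ where $\alpha>0$ is a fixed constant, independent of $K$, satisfying $$\alpha<\frac{1}{10(1+C_{\mathrm{TV}}+C_{\mathcal P}+\kappa)(1\vee C_{\mathrm{TV}})} .$$ Let $\nu^\star$ be a minimizer of $J$ over $\mathcal M_+(\mathcal X)$ and $\hat\rho_K:=\min_{1\le k\le K}\{J(\hat\nu_k)-J(\nu^\star)\}$. Then, for any horizon $K\ge4/\alpha^2$, $$\mathbb E[\hat\rho_K]\le C\,\alpha^{-1/2}\left(\frac{(\log K)^3}{K}\right)^{\frac{1}{2(2+d)}}$$ for a constant $C>0$ not depending on $K$. The total number of oracle calls is $N=\sum_{k=1}^Kk=\frac{K(K+1)}{2}$, and $$\mathbb E[\hat\rho_K]=\mathcal O\left(N^{-\frac{1}{4(2+d)}}(\log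 N)^{\frac{3}{2(2+d)}}\right).$$
   Context: Setting. $\mathcal X\subset\mathbb R^d$ is compact, convex and equal to the closure of its interior. $\mathcal M(\mathcal X)$ is the space of finite signed measures on $\mathcal X$ with total variation norm $\|\cdot\|_{\mathrm{TV}}$, and $\mathcal M_+(\mathcal X)$ the nonnegative ones. $\mathbb H$ is a separable Hilbert space, $\Phi:\mathcal M(\mathcal X)\to\mathbb H$ is bounded, linear and weak-* continuous, so that $\Phi\nu=\int_{\mathcal X}\varphi_t\,d\nu(t)$ with $\varphi_t:=\Phi\delta_t$; the kernel is $K(s,t)=\langle\varphi_s,\varphi_t\rangle_{\mathbb H}$. Given $y\in\mathbb H$ and $\kappa>0$, $J(\nu)=\frac12\|y-\Phi\nu\|_{\mathbb H}^2+\kappa\|\nu\|_{\mathrm{TV}}$ on $\mathcal M_+(\mathcal X)$, and $J'_\nu(t)=\langle\varphi_t,\Phi\nu-y\rangle_{\mathbb H}+\kappa$. For $\nu\in\mathcal M_+(\mathcal X)$, $\|f\|_\nu^2:=\int_{\mathcal X}|f|^2d\nu$. Assumption on the problem: there are $c_{\mathcal P},C_{\mathcal P}>0$ such that $\|y\|_{\mathbb H}\le C_{\mathcal P}$; $K$ is twice continuously differentiable with $\max\{\|K\|_\infty,\|\nabla_sK\|_\infty,\|\nabla_s^2K\|_\infty\}\le C_{\mathcal P}$; $K(s,t)\ge c_{\mathcal P}$ and $K(t,t)=1$ for all $s,t\in\mathcal X$. Oracle: at iteration $k$ a mini-batch of $m_k$ i.i.d. samples is used to form unbiased estimators of the dual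 certificate and its gradient; each sample counts as one oracle call. Filtrations: increasing $\sigma$-algebras with $\mathfrak F_{k-1}\subset\mathfrak F_{k-1}^+\subset\mathfrak F_k\subset\mathfrak F_k^+$, $\hat\nu_k$ is $\mathfrak F_k$-measurable and $\hat\nu_{k^+}$ is $\mathfrak F_k^+$-measurable. Assumptions on the sequences ($\lambda$ is Lebesgue measure; $C,c>0$ are generic constants that may change from line to line and are independent of $k$ and $d$): $(\hat{\mathcal H}^\infty_{\mathrm{TV}})$: there is a constant $C_{\mathrm{TV}}$ with $\|\hat\nu_k\|_{\mathrm{TV}}\le C_{\mathrm{TV}}$ a.s. for all $k$. $(\hat{\mathcal H}_D)$: for any $k\ge1$, $\mathbb E[J(\hat\nu_{k^+})\mid\mathfrak F_k]-J(\hat\nu_k)\le-\frac\alpha2\|J'_{\hat\nu_k}\|^2_{\hat\nu_k}+C\left(\frac{\alpha^2}{m_k}+\beta_k^2+\frac{\beta_k}{m_k}\right)$. $(\hat{\mathcal H}^+_{\varepsilon,a})$, for a given $a>0$: for any $k\ge0$ and Borel $\mathcal B\subseteq\mathcal X$, $\mathbb E[\hat\nu_{k+1}(\mathcal B)\mid\mathfrak F_k^+]\ge c\,\varepsilon_k\,\lambda(\mathcal B\cap\{J'_{\hat\nu_{k^+}}<0\})-C\varepsilon_km_k^{-a}$. $(\hat{\mathcal H}^{\mathrm{smooth},1}_\varepsilon)$: for any $k\ge1$, $\mathbb E[J(\hat\nu_{k+1})-J(\hat\nu_{k^+})\mid\mathfrak F_k^+]\le C\left(\varepsilon_k^2+\varepsilon_k\sqrt{\frac{\log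 m_k}{m_k}}\right)$. $(\hat{\mathcal H}^{\mathrm{smooth},2}_\varepsilon)$: for any $k\ge1$, $\|J'_{\hat\nu_{k+1}}-J'_{\hat\nu_{k^+}}\|_\infty\le C\varepsilon_k$ a.s. *)

theory Defs
  imports "HOL-Probability.Probability" "HOL-Library.Landau_Symbols"
begin

abbreviation borel_on :: "'a::topological_space set \<Rightarrow> 'a measure" where
  "borel_on X \<equiv> restrict_space borel X"

text \<open>Finite nonnegative measures on \<open>X\<close> are elements of the type of measures. Finite signed
  measures are real set functions, set to 0 outside the Borel subsets of \<open>X\<close>, so that equal
  measures are equal functions; \<open>measure M\<close> is the signed measure of a nonnegative \<open>M\<close>.
  Countable additivity includes \<open>\<nu> {} = 0\<close>.\<close>

definition nonneg_measures :: "'a::topological_space set \<Rightarrow> 'a measure set" where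
  "nonneg_measures X = {M. sets M = sets (borel_on X) \<and> finite_measure M}"

definition signed_measures :: "'a::topological_space set \<Rightarrow> ('a set \<Rightarrow> real) set" where
  "signed_measures X = {\<nu>.
     (\<forall>A. range A \<subseteq> sets (borel_on X) \<longrightarrow> disjoint_family A \<longrightarrow>
        (\<lambda>i::nat. \<nu> (A i)) sums \<nu> (\<Union>i. A i)) \<and>
     (\<forall>B. B \<notin> sets (borel_on X) \<longrightarrow> \<nu> B = 0)}"

text \<open>Jordan decomposition: \<open>\<nu>\<^sup>+(B) = sup {\<nu>(A) | A \<subseteq> B Borel}\<close> and \<open>\<nu>\<^sup>- = (-\<nu>)\<^sup>+\<close>.
  The suprema are finite for every finite signed measure.\<close>

definition upper_variation :: "'a::topological_space set \<Rightarrow> ('a set \<Rightarrow> real) \<Rightarrow> 'a set \<Rightarrow> real" where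
  "upper_variation X \<nu> B = (SUP A\<in>{A \<in> sets (borel_on X). A \<subseteq> B}. \<nu> A)"

definition lower_variation :: "'a::topological_space set \<Rightarrow> ('a set \<Rightarrow> real) \<Rightarrow> 'a set \<Rightarrow> real" where
  "lower_variation X \<nu> = upper_variation X (\<lambda>A. - \<nu> A)"

definition tv_norm :: "'a::topological_space set \<Rightarrow> ('a set \<Rightarrow> real) \<Rightarrow> real" where
  "tv_norm X \<nu> = upper_variation X \<nu> X + lower_variation X \<nu> X"

definition measure_from :: "'a::topological_space set \<Rightarrow> ('a set \<Rightarrow> real) \<Rightarrow> 'a measure" where
  "measure_from X \<mu> = measure_of X (sets (borel_on X)) (\<lambda>B. ennreal (\<mu> B))"

definition signed_integral ::
    "'a::topological_space set \<Rightarrow> ('a set \<Rightarrow> real) \<Rightarrow> ('a \<Rightarrow> real) \<Rightarrow> real" where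
  "signed_integral X \<nu> f =
     (\<integral>t. f t \<partial>measure_from X (upper_variation X \<nu>)) -
     (\<integral>t. f t \<partial>measure_from X (lower_variation X \<nu>))"

text \<open>Coarsest topology that makes \<open>\<nu> \<mapsto> \<integral> f d\<nu>\<close> continuous for every continuous \<open>f\<close> on \<open>X\<close>.\<close>

definition weak_star_topology :: "'a::topological_space set \<Rightarrow> ('a set \<Rightarrow> real) topology" where
  "weak_star_topology X =
     pullback_topology (signed_measures X)
       (\<lambda>\<nu>. \<lambda>f\<in>{f. continuous_on X f}. signed_integral X \<nu> f)
       (product_topology (\<lambda>_. euclideanreal) {f. continuous_on X f})"

definition weak_topology :: "'h::real_inner topology" where
  "weak_topology =
     pullback_topology UNIV (\<lambda>h. \<lambda>g. g \<bullet> h) (product_topology (\<lambda>_. euclideanreal) UNIV)"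

text \<open>Weak-* continuity is continuity into the weak topology: a linear map that is continuous
  from the weak-* to the norm topology has finite rank.\<close>

definition measure_operator ::
    "'a::topological_space set \<Rightarrow> (('a set \<Rightarrow> real) \<Rightarrow> 'h::real_inner) \<Rightarrow> bool" where
  "measure_operator X \<Phi> \<longleftrightarrow>
     (\<forall>\<nu>\<in>signed_measures X. \<forall>\<mu>\<in>signed_measures X. \<Phi> (\<lambda>B. \<nu> B + \<mu> B) = \<Phi> \<nu> + \<Phi> \<mu>) \<and>
     (\<forall>\<nu>\<in>signed_measures X. \<forall>r. \<Phi> (\<lambda>B. r * \<nu> B) = r *\<^sub>R \<Phi> \<nu>) \<and>
     (\<exists>b. \<forall>\<nu>\<in>signed_measures X. norm (\<Phi> \<nu>) \<le> b * tv_norm X \<nu>) \<and>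
     continuous_map (weak_star_topology X) weak_topology \<Phi>"

definition feature ::
    "'a::topological_space set \<Rightarrow> (('a set \<Rightarrow> real) \<Rightarrow> 'h) \<Rightarrow> 'a \<Rightarrow> 'h" where
  "feature X \<Phi> t = \<Phi> (measure (return (borel_on X) t))"

definition feature_kernel ::
    "'a::topological_space set \<Rightarrow> (('a set \<Rightarrow> real) \<Rightarrow> 'h::real_inner) \<Rightarrow> 'a \<Rightarrow> 'a \<Rightarrow> real" where
  "feature_kernel X \<Phi> s t = feature X \<Phi> s \<bullet> feature X \<Phi> t"

definition objective ::
    "'a::topological_space set \<Rightarrow> (('a set \<Rightarrow> real) \<Rightarrow> 'h::real_inner) \<Rightarrow> 'h \<Rightarrow> real \<Rightarrow>
     'a measure \<Rightarrow> real" where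
  "objective X \<Phi> y \<kappa> M = (norm (y - \<Phi> (measure M)))\<^sup>2 / 2 + \<kappa> * tv_norm X (measure M)"

definition certificate ::
    "'a::topological_space set \<Rightarrow> (('a set \<Rightarrow> real) \<Rightarrow> 'h::real_inner) \<Rightarrow> 'h \<Rightarrow> real \<Rightarrow>
     'a measure \<Rightarrow> 'a \<Rightarrow> real" where
  "certificate X \<Phi> y \<kappa> M t = feature X \<Phi> t \<bullet> (\<Phi> (measure M) - y) + \<kappa>"

definition measure_norm :: "'a measure \<Rightarrow> ('a \<Rightarrow> real) \<Rightarrow> real" where
  "measure_norm M f = sqrt (\<integral>t. \<bar>f t\<bar>\<^sup>2 \<partial>M)"

definition is_minimizer ::
    "'a::topological_space set \<Rightarrow> (('a set \<Rightarrow> real) \<Rightarrow> 'h::real_inner) \<Rightarrow> 'h \<Rightarrow> real \<Rightarrow>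
     'a measure \<Rightarrow> bool" where
  "is_minimizer X \<Phi> y \<kappa> M \<longleftrightarrow>
     M \<in> nonneg_measures X \<and> (\<forall>N\<in>nonneg_measures X. objective X \<Phi> y \<kappa> M \<le> objective X \<Phi> y \<kappa> N)"

text \<open>Derivatives on the closed set \<open>X\<close> (or \<open>X \<times> X\<close>) are derivatives within that set. They are
  unique, because the sets in question are convex and the closure of their interior.\<close>

definition C2_on :: "'a::real_normed_vector set \<Rightarrow> ('a \<Rightarrow> 'b::real_normed_vector) \<Rightarrow> bool" where
  "C2_on S f \<longleftrightarrow> (\<exists>(f' :: 'a \<Rightarrow> 'a \<Rightarrow>\<^sub>L 'b) (f'' :: 'a \<Rightarrow> 'a \<Rightarrow>\<^sub>L ('a \<Rightarrow>\<^sub>L 'b)).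
     (\<forall>x\<in>S. (f has_derivative blinfun_apply (f' x)) (at x within S)) \<and>
     (\<forall>x\<in>S. (f' has_derivative blinfun_apply (f'' x)) (at x within S)) \<and>
     continuous_on S f'')"

definition gradient_within :: "'a::euclidean_space set \<Rightarrow> ('a \<Rightarrow> real) \<Rightarrow> 'a \<Rightarrow> 'a" where
  "gradient_within X f s = (THE g. (f has_derivative (\<lambda>h. g \<bullet> h)) (at s within X))"

definition hessian_within :: "'a::euclidean_space set \<Rightarrow> ('a \<Rightarrow> real) \<Rightarrow> 'a \<Rightarrow> 'a \<Rightarrow> 'a" where
  "hessian_within X f s = frechet_derivative (gradient_within X f) (at s within X)"

definition problem_assumption ::
    "'a::euclidean_space set \<Rightarrow> (('a set \<Rightarrow> real) \<Rightarrow> 'h::real_inner) \<Rightarrow> 'h \<Rightarrow> real \<Rightarrow> real \<Rightarrow> bool" where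
  "problem_assumption X \<Phi> y c\<^sub>P C\<^sub>P \<longleftrightarrow>
     0 < c\<^sub>P \<and> 0 < C\<^sub>P \<and> norm y \<le> C\<^sub>P \<and>
     C2_on (X \<times> X) (\<lambda>(s, t). feature_kernel X \<Phi> s t) \<and>
     (\<forall>s\<in>X. \<forall>t\<in>X.
        \<bar>feature_kernel X \<Phi> s t\<bar> \<le> C\<^sub>P \<and>
        norm (gradient_within X (\<lambda>u. feature_kernel X \<Phi> u t) s) \<le> C\<^sub>P \<and>
        onorm (hessian_within X (\<lambda>u. feature_kernel X \<Phi> u t) s) \<le> C\<^sub>P \<and>
        c\<^sub>P \<le> feature_kernel X \<Phi> s t) \<and>
     (\<forall>t\<in>X. feature_kernel X \<Phi> t t = 1)"

text \<open>Throughout, \<open>\<nu> k\<close> stands for the iterate at time \<open>k\<close> and \<open>\<nu>p k\<close> for the intermediate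
  iterate at time \<open>k\<^sup>+\<close>; likewise \<open>F k\<close> and \<open>Fp k\<close>. The index 0 is included because
  \<open>hyp_birth\<close> at \<open>k = 0\<close> refers to time \<open>0\<^sup>+\<close>.\<close>

definition interlaced_filtrations ::
    "'w measure \<Rightarrow> (nat \<Rightarrow> 'w measure) \<Rightarrow> (nat \<Rightarrow> 'w measure) \<Rightarrow> bool" where
  "interlaced_filtrations P F Fp \<longleftrightarrow>
     (\<forall>k. subalgebra P (F k) \<and> subalgebra P (Fp k) \<and>
          subalgebra (Fp k) (F k) \<and> subalgebra (F (Suc k)) (Fp k))"

text \<open>A random element of the nonnegative measures on \<open>X\<close>, with the \<open>\<sigma>\<close>-algebra generated by
  the evaluations at Borel sets.\<close>

definition random_measure ::
    "'a::topological_space set \<Rightarrow> 'w measure \<Rightarrow> ('w \<Rightarrow> 'a measure) \<Rightarrow> bool" where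
  "random_measure X G \<mu> \<longleftrightarrow>
     (\<forall>\<omega>\<in>space G. \<mu> \<omega> \<in> nonneg_measures X) \<and>
     (\<forall>B\<in>sets (borel_on X). (\<lambda>\<omega>. measure (\<mu> \<omega>) B) \<in> borel_measurable G)"

definition hyp_TV ::
    "'a::topological_space set \<Rightarrow> 'w measure \<Rightarrow> (nat \<Rightarrow> 'w \<Rightarrow> 'a measure) \<Rightarrow> real \<Rightarrow> bool" where
  "hyp_TV X P \<nu> C\<^sub>T\<^sub>V \<longleftrightarrow> (\<forall>k. AE \<omega> in P. tv_norm X (measure (\<nu> k \<omega>)) \<le> C\<^sub>T\<^sub>V)"

text \<open>The following hypotheses take the functional \<open>J\<close> and its certificate \<open>J'\<close> as arguments.
  Integrability is stated where a conditional expectation is not that of an almost surely bounded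
  variable, since \<open>real_cond_exp\<close> is total.\<close>

definition hyp_D ::
    "'w measure \<Rightarrow> (nat \<Rightarrow> 'w measure) \<Rightarrow> (nat \<Rightarrow> 'w \<Rightarrow> 'a measure) \<Rightarrow> (nat \<Rightarrow> 'w \<Rightarrow> 'a measure) \<Rightarrow>
     ('a measure \<Rightarrow> real) \<Rightarrow> ('a measure \<Rightarrow> 'a \<Rightarrow> real) \<Rightarrow>
     real \<Rightarrow> (nat \<Rightarrow> nat) \<Rightarrow> (nat \<Rightarrow> real) \<Rightarrow> real \<Rightarrow> bool" where
  "hyp_D P F \<nu> \<nu>p J J' \<alpha> m \<beta> C \<longleftrightarrow>
     (\<forall>k\<ge>1. integrable P (\<lambda>\<omega>. J (\<nu>p k \<omega>)) \<and>
        (AE \<omega> in P. real_cond_exp P (F k) (\<lambda>\<omega>. J (\<nu>p k \<omega>)) \<omega> - J (\<nu> k \<omega>)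
           \<le> - (\<alpha> / 2) * (measure_norm (\<nu> k \<omega>) (J' (\<nu> k \<omega>)))\<^sup>2
             + C * (\<alpha>\<^sup>2 / real (m k) + (\<beta> k)\<^sup>2 + \<beta> k / real (m k))))"

definition hyp_birth ::
    "'a::euclidean_space set \<Rightarrow> 'w measure \<Rightarrow> (nat \<Rightarrow> 'w measure) \<Rightarrow>
     (nat \<Rightarrow> 'w \<Rightarrow> 'a measure) \<Rightarrow> (nat \<Rightarrow> 'w \<Rightarrow> 'a measure) \<Rightarrow> ('a measure \<Rightarrow> 'a \<Rightarrow> real) \<Rightarrow>
     real \<Rightarrow> (nat \<Rightarrow> nat) \<Rightarrow> (nat \<Rightarrow> real) \<Rightarrow> real \<Rightarrow> real \<Rightarrow> bool" where
  "hyp_birth X P Fp \<nu> \<nu>p J' a m \<epsilon> c C \<longleftrightarrow>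
     (\<forall>k. \<forall>B\<in>sets (borel_on X). AE \<omega> in P.
        c * \<epsilon> k * measure lborel (B \<inter> {t \<in> X. J' (\<nu>p k \<omega>) t < 0}) - C * \<epsilon> k * real (m k) powr (- a)
          \<le> real_cond_exp P (Fp k) (\<lambda>\<omega>. measure (\<nu> (Suc k) \<omega>) B) \<omega>)"

definition hyp_smooth1 ::
    "'w measure \<Rightarrow> (nat \<Rightarrow> 'w measure) \<Rightarrow> (nat \<Rightarrow> 'w \<Rightarrow> 'a measure) \<Rightarrow> (nat \<Rightarrow> 'w \<Rightarrow> 'a measure) \<Rightarrow>
     ('a measure \<Rightarrow> real) \<Rightarrow> (nat \<Rightarrow> nat) \<Rightarrow> (nat \<Rightarrow> real) \<Rightarrow> real \<Rightarrow> bool" where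
  "hyp_smooth1 P Fp \<nu> \<nu>p J m \<epsilon> C \<longleftrightarrow>
     (\<forall>k\<ge>1. integrable P (\<lambda>\<omega>. J (\<nu> (Suc k) \<omega>) - J (\<nu>p k \<omega>)) \<and>
        (AE \<omega> in P. real_cond_exp P (Fp k) (\<lambda>\<omega>. J (\<nu> (Suc k) \<omega>) - J (\<nu>p k \<omega>)) \<omega>
           \<le> C * ((\<epsilon> k)\<^sup>2 + \<epsilon> k * sqrt (ln (real (m k)) / real (m k)))))"

definition hyp_smooth2 ::
    "'a set \<Rightarrow> 'w measure \<Rightarrow> (nat \<Rightarrow> 'w \<Rightarrow> 'a measure) \<Rightarrow> (nat \<Rightarrow> 'w \<Rightarrow> 'a measure) \<Rightarrow>
     ('a measure \<Rightarrow> 'a \<Rightarrow> real) \<Rightarrow> (nat \<Rightarrow> real) \<Rightarrow> real \<Rightarrow> bool" where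
  "hyp_smooth2 X P \<nu> \<nu>p J' \<epsilon> C \<longleftrightarrow>
     (\<forall>k\<ge>1. AE \<omega> in P. \<forall>t\<in>X. \<bar>J' (\<nu> (Suc k) \<omega>) t - J' (\<nu>p k \<omega>) t\<bar> \<le> C * \<epsilon> k)"

definition batch_size :: "nat \<Rightarrow> nat" where
  "batch_size k = max k 1"

definition birth_rate :: "real \<Rightarrow> nat \<Rightarrow> real" where
  "birth_rate \<alpha> k = min \<alpha> (1 / sqrt (real (max k 1)))"

definition beta_schedule :: "nat \<Rightarrow> real" where
  "beta_schedule k = 1 / real (max k 1)"

definition best_gap ::
    "('a measure \<Rightarrow> real) \<Rightarrow> (nat \<Rightarrow> 'w \<Rightarrow> 'a measure) \<Rightarrow> 'a measure \<Rightarrow> nat \<Rightarrow> 'w \<Rightarrow> real" where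
  "best_gap J \<nu> \<nu>star K \<omega> = Min ((\<lambda>k. J (\<nu> k \<omega>) - J \<nu>star) ` {1..K})"

definition oracle_calls :: "nat \<Rightarrow> nat" where
  "oracle_calls K = (\<Sum>k=1..K. batch_size k)"

end

theory Submission
  imports Defs
begin

text \<open>The gap of an iterate \<open>\<nu>\<^sub>k\<close> is controlled by its certificate. Since the quadratic term is convex,
  \<open>J(\<nu>\<^sub>k) - J(\<nu>\<^sup>\<star>) \<le> \<integral>J'\<^sub>k d\<nu>\<^sub>k - \<integral>J'\<^sub>k d\<nu>\<^sup>\<star>\<close>, where \<open>J'\<^sub>k\<close> is the certificate of \<open>\<nu>\<^sub>k\<close>. The first integral
  is at most \<open>\<eta> \<nu>\<^sub>k(X) + N\<^sub>k / \<eta>\<close> with \<open>N\<^sub>k = \<parallel>J'\<^sub>k\<parallel>\<^sup>2\<close> taken in \<open>L\<^sup>2(\<nu>\<^sub>k)\<close>, and the second one costs the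
  largest violation \<open>S\<^sub>k = sup (- J'\<^sub>k)\<close> times the mass of \<open>\<nu>\<^sup>\<star>\<close> (\<open>objective_gap_bound\<close>).

  Both quantities are paid for by descent. Adding up the descent and birth hypotheses, the objective
  telescopes and \<open>\<alpha> \<Sum>\<^sub>k\<^sub>\<le>\<^sub>K E N\<^sub>k\<close> is of order \<open>(log K)\<^sup>3\<^sup>/\<^sup>2\<close>, so some index in the second half of the
  horizon has \<open>E N\<^sub>k\<close> of order \<open>u = (log K)\<^sup>3\<^sup>/\<^sup>2 / (\<alpha> K)\<close> (\<open>exists_small_decrease\<close>). A violation is turned
  into a contribution to \<open>N\<^sub>k\<close> as follows (\<open>violation_bound\<close>). Certificates are Lipschitz, so a violation
  of size \<open>S \<ge> d\<^sub>0\<close> persists, up to a fixed factor, on a ball of radius proportional to \<open>d\<^sub>0\<close>. By convexity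
  of \<open>X\<close> this ball has volume of order \<open>d\<^sub>0\<^sup>d\<close> within \<open>X\<close> (\<open>convex_cball_volume\<close>), hence the next birth puts
  mass of order \<open>\<epsilon> d\<^sub>0\<^sup>d\<close> there in expectation, which contributes \<open>\<epsilon> d\<^sub>0\<^sup>d S\<^sup>2\<close> to \<open>N\<^sub>k\<close>. Therefore \<open>E S\<close> is
  at most of order \<open>d\<^sub>0 + u / (\<epsilon> d\<^sub>0\<^sup>d\<^sup>+\<^sup>1)\<close>. With \<open>\<epsilon>\<close> of order \<open>1 / \<surd>K\<close> this is balanced by \<open>d\<^sub>0\<^sup>d\<^sup>+\<^sup>2\<close> of order
  \<open>\<surd>K u = (log K)\<^sup>3\<^sup>/\<^sup>2 / (\<alpha> \<surd>K)\<close>, which is the stated exponent; \<open>\<eta> = d\<^sub>0\<close>, up to a constant, makes the other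
  part of the gap no larger. The condition on \<open>a\<close> says that the sampling noise \<open>K\<^sup>-\<^sup>a\<close> of the births is of lower
  or equal order than the volume \<open>d\<^sub>0\<^sup>d\<close> (\<open>expectation_best_gap_rate\<close>).

  Two facts about the operator underlie this. Weak-* continuity yields \<open>\<langle>g, \<Phi> \<nu>\<rangle> = \<integral>\<langle>g, \<phi>\<^sub>t\<rangle> d\<nu>(t)\<close>
  (\<open>inner_measure_operator\<close>), and \<open>\<parallel>\<phi>\<^sub>s - \<phi>\<^sub>t\<parallel>\<^sup>2\<close> is a mixed second difference of the kernel, so
  twice continuous differentiability makes the features Lipschitz (\<open>feature_lipschitz_of_C2\<close>).\<close>


section \<open>Finite measures as signed measures\<close>

lemma space_nonneg_measure:
  assumes "M \<in> nonneg_measures X"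
  shows "space M = X"
  using assms sets_eq_imp_space_eq[of M "borel_on X"]
  by (auto simp: nonneg_measures_def space_restrict_space)

lemma upper_variation_measure:
  assumes M: "M \<in> nonneg_measures X" and B: "B \<in> sets (borel_on X)"
  shows "upper_variation X (measure M) B = measure M B"
proof -
  interpret finite_measure M using M by (simp add: nonneg_measures_def)
  have s: "sets M = sets (borel_on X)" using M by (simp add: nonneg_measures_def)
  show ?thesis
    unfolding upper_variation_def
    by (rule cSup_eq_maximum) (use B s in \<open>auto intro!: finite_measure_mono\<close>)
qed

lemma lower_variation_measure:
  assumes M: "M \<in> nonneg_measures X"
  shows "lower_variation X (measure M) B = 0"
  unfolding lower_variation_def upper_variation_def
proof (rule cSup_eq_maximum)
  show "0 \<in> (\<lambda>A. - measure M A) ` {A \<in> sets (borel_on X). A \<subseteq> B}"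
    by (rule image_eqI[of _ _ "{}"]) auto
qed auto

lemma space_in_borel_on: "X \<in> sets (borel_on X)"
  using sets.top[of "borel_on X"] by (simp add: space_restrict_space)

lemma tv_norm_measure:
  assumes "M \<in> nonneg_measures X"
  shows "tv_norm X (measure M) = measure M X"
  using upper_variation_measure[OF assms space_in_borel_on] lower_variation_measure[OF assms]
  by (simp add: tv_norm_def)

lemma borel_on_subset_Pow: "sets (borel_on X) \<subseteq> Pow X"
  using sets.space_closed[of "borel_on X"] by (simp add: space_restrict_space)

lemma measure_from_upper_variation:
  assumes M: "M \<in> nonneg_measures X"
  shows "measure_from X (upper_variation X (measure M)) = M"
proof -
  interpret finite_measure M using M by (simp add: nonneg_measures_def)
  have s: "sets M = sets (borel_on X)" using M by (simp add: nonneg_measures_def)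
  have sg: "sigma_sets X (sets (borel_on X)) = sets (borel_on X)"
    using sets.sigma_sets_eq[of "borel_on X"] by (simp add: space_restrict_space)
  have "measure_from X (upper_variation X (measure M)) = measure_of X (sets (borel_on X)) (emeasure M)"
    unfolding measure_from_def
    by (rule measure_of_eq[OF borel_on_subset_Pow])
       (simp add: sg upper_variation_measure[OF M] emeasure_eq_measure)
  also have "\<dots> = M"
    using measure_of_of_measure[of M] s space_nonneg_measure[OF M] by simp
  finally show ?thesis .
qed

lemma measure_from_lower_variation:
  assumes M: "M \<in> nonneg_measures X"
  shows "measure_from X (lower_variation X (measure M)) = null_measure (borel_on X)"
proof -
  have "measure_from X (lower_variation X (measure M)) =
      measure_of X (sets (borel_on X)) (emeasure (null_measure (borel_on X)))"
    unfolding measure_from_def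
    by (rule measure_of_eq[OF borel_on_subset_Pow])
       (simp add: lower_variation_measure[OF M])
  also have "\<dots> = null_measure (borel_on X)"
    using measure_of_of_measure[of "null_measure (borel_on X)"]
    by (simp add: space_restrict_space)
  finally show ?thesis .
qed

lemma signed_integral_measure:
  assumes "M \<in> nonneg_measures X"
  shows "signed_integral X (measure M) f = (\<integral>t. f t \<partial>M)"
  by (simp add: signed_integral_def measure_from_upper_variation[OF assms]
      measure_from_lower_variation[OF assms])

lemma measure_in_signed_measures:
  assumes M: "M \<in> nonneg_measures X"
  shows "measure M \<in> signed_measures X"
proof -
  interpret finite_measure M using M by (simp add: nonneg_measures_def)
  have s: "sets M = sets (borel_on X)" using M by (simp add: nonneg_measures_def)
  show ?thesis
    unfolding signed_measures_def
    using finite_measure_UNION s by (auto simp: measure_notin_sets)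
qed

lemma signed_measures_zero: "(\<lambda>B. 0) \<in> signed_measures X"
  by (simp add: signed_measures_def)

lemma signed_measures_add:
  assumes "\<mu> \<in> signed_measures X" "\<nu> \<in> signed_measures X"
  shows "(\<lambda>B. \<mu> B + \<nu> B) \<in> signed_measures X"
  using assms by (auto simp: signed_measures_def intro!: sums_add)

lemma signed_measures_scale:
  assumes "\<mu> \<in> signed_measures X"
  shows "(\<lambda>B. r * \<mu> B) \<in> signed_measures X"
  using assms by (auto simp: signed_measures_def intro!: sums_mult)

lemma measure_operatorD:
  assumes "measure_operator X \<Phi>"
  shows "\<nu> \<in> signed_measures X \<Longrightarrow> \<mu> \<in> signed_measures X \<Longrightarrow> \<Phi> (\<lambda>B. \<nu> B + \<mu> B) = \<Phi> \<nu> + \<Phi> \<mu>"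
    and "\<nu> \<in> signed_measures X \<Longrightarrow> \<Phi> (\<lambda>B. r * \<nu> B) = r *\<^sub>R \<Phi> \<nu>"
    and "continuous_map (weak_star_topology X) weak_topology \<Phi>"
  using assms by (simp_all add: measure_operator_def)

lemma measure_operator_sum:
  assumes op: "measure_operator X \<Phi>" and "finite S"
    and "\<And>i. i \<in> S \<Longrightarrow> \<mu> i \<in> signed_measures X"
  shows "(\<lambda>B. \<Sum>i\<in>S. r i * \<mu> i B) \<in> signed_measures X \<and>
    \<Phi> (\<lambda>B. \<Sum>i\<in>S. r i * \<mu> i B) = (\<Sum>i\<in>S. r i *\<^sub>R \<Phi> (\<mu> i))"
  using assms(2,3)
proof (induction S rule: finite_induct)
  case empty
  have "\<Phi> (\<lambda>B. 0) = 0"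
    using measure_operatorD(2)[OF op signed_measures_zero, of 0] by simp
  then show ?case using signed_measures_zero by simp
next
  case (insert i S)
  let ?S = "\<lambda>B. \<Sum>i\<in>S. r i * \<mu> i B" and ?i = "\<lambda>B. r i * \<mu> i B"
  have m: "\<mu> i \<in> signed_measures X" using insert by simp
  have s: "?S \<in> signed_measures X" and e: "\<Phi> ?S = (\<Sum>i\<in>S. r i *\<^sub>R \<Phi> (\<mu> i))"
    using insert by auto
  have i: "?i \<in> signed_measures X" and ei: "\<Phi> ?i = r i *\<^sub>R \<Phi> (\<mu> i)"
    using signed_measures_scale[OF m] measure_operatorD(2)[OF op m] by blast+
  have "\<Phi> (\<lambda>B. ?i B + ?S B) = \<Phi> ?i + \<Phi> ?S"
    by (rule measure_operatorD(1)[OF op i s])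
  then show ?case
    using signed_measures_add[OF i s] insert.hyps e ei by simp
qed

section \<open>Integral representation of weak-* continuous operators\<close>

lemma limitin_pullback_topology:
  assumes "l \<in> A" and "\<And>n. x n \<in> A" and "limitin T (\<lambda>n. f (x n)) (f l) F"
  shows "limitin (pullback_topology A f T) x l F"
  using assms unfolding limitin_def openin_pullback_topology topspace_pullback_topology
  by (auto elim!: eventually_mono)

lemma measure_operator_weak_limit:
  assumes op: "measure_operator X \<Phi>"
    and M: "M \<in> nonneg_measures X" and N: "\<And>n. N n \<in> nonneg_measures X"
    and lim: "\<And>f :: _ \<Rightarrow> real. continuous_on X f \<Longrightarrow> (\<lambda>n. \<integral>t. f t \<partial>N n) \<longlonglongrightarrow> (\<integral>t. f t \<partial>M)"
  shows "(\<lambda>n. g \<bullet> \<Phi> (measure (N n))) \<longlonglongrightarrow> g \<bullet> \<Phi> (measure M)"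
proof -
  have "limitin (weak_star_topology X) (\<lambda>n. measure (N n)) (measure M) sequentially"
    unfolding weak_star_topology_def
    using lim by (intro limitin_pullback_topology)
       (auto simp: measure_in_signed_measures M N limitin_componentwise signed_integral_measure)
  then have "limitin weak_topology (\<Phi> \<circ> (\<lambda>n. measure (N n))) (\<Phi> (measure M)) sequentially"
    by (rule continuous_map_limit[OF measure_operatorD(3)[OF op]])
  moreover have "continuous_map weak_topology euclideanreal ((\<lambda>x. x g) \<circ> (\<lambda>h. \<lambda>g. g \<bullet> h))"
    unfolding weak_topology_def
    by (intro continuous_map_pullback continuous_map_product_projection) auto
  ultimately have "limitin euclideanreal (((\<lambda>x. x g) \<circ> (\<lambda>h. \<lambda>g. g \<bullet> h)) \<circ> (\<Phi> \<circ> (\<lambda>n. measure (N n))))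
      (((\<lambda>x. x g) \<circ> (\<lambda>h. \<lambda>g. g \<bullet> h)) (\<Phi> (measure M))) sequentially"
    by (rule continuous_map_limit[rotated])
  then show ?thesis by (simp add: o_def)
qed

text \<open>Simple functions that converge to the identity may leave \<open>X\<close>; composing them with the projection
  onto the convex set \<open>X\<close> brings them back without changing the limit on \<open>X\<close>.\<close>

lemma finite_range_approximation:
  fixes X :: "'a::euclidean_space set"
  assumes "closed X" "convex X" "X \<noteq> {}"
  obtains q :: "nat \<Rightarrow> 'a \<Rightarrow> 'a" where
    "\<And>n. q n \<in> borel_on X \<rightarrow>\<^sub>M borel_on X" "\<And>n. finite (q n ` X)"
    "\<And>n t. t \<in> X \<Longrightarrow> q n t \<in> X" "\<And>t. t \<in> X \<Longrightarrow> (\<lambda>n. q n t) \<longlonglongrightarrow> t"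
proof -
  have "(\<lambda>t::'a. t) \<in> borel_measurable (borel_on X)"
    by (rule measurable_restrict_space1) simp
  from borel_measurable_implies_sequence_metric[OF this, of undefined]
  obtain F :: "nat \<Rightarrow> 'a \<Rightarrow> 'a" where F: "\<And>n. simple_function (borel_on X) (F n)"
    "\<And>t. t \<in> X \<Longrightarrow> (\<lambda>n. F n t) \<longlonglongrightarrow> t"
    by (auto simp: space_restrict_space)
  have cl: "continuous_on UNIV (closest_point X)"
    using assms continuous_on_closest_point by blast
  have in_X: "closest_point X t \<in> X" for t
    using assms closest_point_in_set by blast
  show thesis
  proof
    fix n
    have "F n \<in> borel_measurable (borel_on X)"
      using F(1) borel_measurable_simple_function by blast
    then have "(\<lambda>t. closest_point X (F n t)) \<in> borel_measurable (borel_on X)"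
      using borel_measurable_continuous_on[OF cl] by blast
    then show "(\<lambda>t. closest_point X (F n t)) \<in> borel_on X \<rightarrow>\<^sub>M borel_on X"
      by (rule measurable_restrict_space2[rotated]) (simp add: in_X)
    have "finite (F n ` X)"
      using F(1)[of n] by (auto simp: simple_function_def space_restrict_space)
    then show "finite ((\<lambda>t. closest_point X (F n t)) ` X)"
      by (metis finite_imageI image_image)
    show "closest_point X (F n t) \<in> X" for t by (rule in_X)
  next
    fix t assume "t \<in> X"
    then have "(\<lambda>n. closest_point X (F n t)) \<longlonglongrightarrow> closest_point X t"
      using F(2) cl by (intro isCont_tendsto_compose[of _ "closest_point X"])
        (auto simp: continuous_on_eq_continuous_at)
    then show "(\<lambda>n. closest_point X (F n t)) \<longlonglongrightarrow> t"
      using closest_point_self[OF \<open>t \<in> X\<close>] by simp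
  qed
qed

lemma continuous_on_borel_on:
  assumes "continuous_on X f"
  shows "f \<in> borel_measurable (borel_on X)"
  using assms by (rule borel_measurable_continuous_on_restrict)

lemma integrable_continuous_on:
  fixes f :: "'a::euclidean_space \<Rightarrow> real"
  assumes "compact X" "continuous_on X f" and M: "M \<in> nonneg_measures X"
  shows "integrable M f"
proof -
  interpret finite_measure M using M by (simp add: nonneg_measures_def)
  have s: "sets M = sets (borel_on X)" using M by (simp add: nonneg_measures_def)
  obtain b where b: "\<And>t. t \<in> X \<Longrightarrow> norm (f t) \<le> b"
    using compact_imp_bounded[OF compact_continuous_image[OF assms(2,1)]]
    by (auto simp: bounded_iff)
  have "f \<in> borel_measurable M"
    using continuous_on_borel_on[OF assms(2)] measurable_cong_sets[OF s refl] by blast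
  then show ?thesis
    by (intro integrable_const_bound[of f b]) (use b space_nonneg_measure[OF M] in auto)
qed

lemma discretised_integral_tendsto:
  fixes f :: "'a::euclidean_space \<Rightarrow> real"
  assumes "compact X" "continuous_on X f" and M: "M \<in> nonneg_measures X"
    and q: "\<And>n. q n \<in> borel_on X \<rightarrow>\<^sub>M borel_on X" "\<And>n t. t \<in> X \<Longrightarrow> q n t \<in> X"
      "\<And>t. t \<in> X \<Longrightarrow> (\<lambda>n. q n t) \<longlonglongrightarrow> t"
  shows "(\<lambda>n. \<integral>t. f (q n t) \<partial>M) \<longlonglongrightarrow> (\<integral>t. f t \<partial>M)"
proof -
  interpret finite_measure M using M by (simp add: nonneg_measures_def)
  have s: "sets M = sets (borel_on X)" using M by (simp add: nonneg_measures_def)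
  have sp: "space M = X" by (rule space_nonneg_measure[OF M])
  obtain b where b: "\<And>t. t \<in> X \<Longrightarrow> norm (f t) \<le> b"
    using compact_imp_bounded[OF compact_continuous_image[OF assms(2,1)]]
    by (auto simp: bounded_iff)
  have fm: "f \<in> borel_measurable (borel_on X)" by (rule continuous_on_borel_on[OF assms(2)])
  have meas: "h \<in> borel_measurable (borel_on X) \<Longrightarrow> h \<in> borel_measurable M" for h :: "'a \<Rightarrow> real"
    using measurable_cong_sets[OF s refl] by blast
  show ?thesis
  proof (rule integral_dominated_convergence[where w = "\<lambda>_. b"])
    show "f \<in> borel_measurable M" using fm meas by blast
    show "(\<lambda>t. f (q n t)) \<in> borel_measurable M" for n
      by (intro meas measurable_compose[OF q(1) fm])
    show "AE t in M. (\<lambda>n. f (q n t)) \<longlonglongrightarrow> f t"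
      using assms(2) q(2,3) sp
      by (intro AE_I2) (auto simp: continuous_on_sequentially o_def)
    show "AE t in M. norm (f (q n t)) \<le> b" for n
      using b q(2) sp by (intro AE_I2) auto
  qed simp
qed

lemma discretised_integral_sum:
  fixes f :: "'a::euclidean_space \<Rightarrow> real"
  assumes M: "M \<in> nonneg_measures X" and q: "q \<in> borel_on X \<rightarrow>\<^sub>M borel_on X" "finite (q ` X)"
  shows "(\<integral>t. f (q t) \<partial>M) = (\<Sum>x\<in>q ` X. f x * measure M (q -` {x} \<inter> X))"
proof -
  interpret finite_measure M using M by (simp add: nonneg_measures_def)
  have s: "sets M = sets (borel_on X)" using M by (simp add: nonneg_measures_def)
  have sp: "space M = X" by (rule space_nonneg_measure[OF M])
  have sets: "q -` {x} \<inter> X \<in> sets M" if "x \<in> q ` X" for x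
  proof -
    have "x \<in> X" using that measurable_space[OF q(1)] by (auto simp: space_restrict_space)
    then have "{x} = {x} \<inter> X" by auto
    then have "{x} \<in> sets (borel_on X)"
      by (auto simp: sets_restrict_space intro!: image_eqI[of _ _ "{x}"])
    then show ?thesis using measurable_sets[OF q(1)] s by (simp add: space_restrict_space)
  qed
  have "(\<integral>t. f (q t) \<partial>M) = (\<integral>t. (\<Sum>x\<in>q ` X. f x * indicator (q -` {x} \<inter> X) t) \<partial>M)"
  proof (rule Bochner_Integration.integral_cong[OF refl])
    fix t assume "t \<in> space M"
    then have "t \<in> X" by (simp add: sp)
    then have "(\<Sum>x\<in>q ` X. f x * indicator (q -` {x} \<inter> X) t) = (\<Sum>x\<in>{q t}. f x)"
      using q(2) by (intro sum.mono_neutral_cong_right) (auto split: split_indicator)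
    then show "f (q t) = (\<Sum>x\<in>q ` X. f x * indicator (q -` {x} \<inter> X) t)" by simp
  qed
  also have "\<dots> = (\<Sum>x\<in>q ` X. \<integral>t. f x * indicator (q -` {x} \<inter> X) t \<partial>M)"
    using sets by (intro Bochner_Integration.integral_sum integrable_mult_right)
      (auto simp: less_top[symmetric])
  also have "\<dots> = (\<Sum>x\<in>q ` X. f x * measure M (q -` {x} \<inter> X))"
    using sets by (intro sum.cong) (auto simp: sp Int_assoc)
  finally show ?thesis .
qed

lemma return_in_nonneg_measures:
  assumes "t \<in> X" shows "return (borel_on X) t \<in> nonneg_measures X"
  using prob_space_return[of t "borel_on X"] assms
  by (auto simp: nonneg_measures_def space_restrict_space prob_space_def)

lemma discretised_feature_sum:
  fixes X :: "'a::euclidean_space set"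
  assumes op: "measure_operator X \<Phi>" and M: "M \<in> nonneg_measures X"
    and q: "q \<in> borel_on X \<rightarrow>\<^sub>M borel_on X" "finite (q ` X)"
  shows "g \<bullet> \<Phi> (measure (distr M (borel_on X) q)) =
    (\<Sum>x\<in>q ` X. (g \<bullet> feature X \<Phi> x) * measure M (q -` {x} \<inter> X))"
proof -
  interpret finite_measure M using M by (simp add: nonneg_measures_def)
  have s: "sets M = sets (borel_on X)" using M by (simp add: nonneg_measures_def)
  have sp: "space M = X" by (rule space_nonneg_measure[OF M])
  have qM: "q \<in> M \<rightarrow>\<^sub>M borel_on X" using q(1) measurable_cong_sets[OF s refl] by blast
  have qX: "q ` X \<subseteq> X" using measurable_space[OF q(1)] by (auto simp: space_restrict_space)
  have "measure (distr M (borel_on X) q) B =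
      (\<Sum>x\<in>q ` X. measure M (q -` {x} \<inter> X) * measure (return (borel_on X) x) B)" for B
  proof (cases "B \<in> sets (borel_on X)")
    case True
    have "measure (distr M (borel_on X) q) B = (\<integral>t. indicator B (q t) \<partial>M)"
      using True qM by (simp add: integral_distr[symmetric])
    also have "\<dots> = (\<Sum>x\<in>q ` X. indicator B x * measure M (q -` {x} \<inter> X))"
      by (rule discretised_integral_sum[OF M q])
    also have "\<dots> = (\<Sum>x\<in>q ` X. measure M (q -` {x} \<inter> X) * measure (return (borel_on X) x) B)"
      using True qX by (intro sum.cong refl) (auto simp: measure_return mult.commute)
    finally show ?thesis .
  qed (simp add: measure_notin_sets)
  then have "\<Phi> (measure (distr M (borel_on X) q)) =
      \<Phi> (\<lambda>B. \<Sum>x\<in>q ` X. measure M (q -` {x} \<inter> X) * measure (return (borel_on X) x) B)"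
    by presburger
  also have "\<dots> = (\<Sum>x\<in>q ` X. measure M (q -` {x} \<inter> X) *\<^sub>R feature X \<Phi> x)"
    unfolding feature_def
    by (rule measure_operator_sum[OF op q(2), of "\<lambda>x. measure (return (borel_on X) x)", THEN conjunct2])
       (use qX in \<open>blast intro: measure_in_signed_measures return_in_nonneg_measures\<close>)
  finally show ?thesis
    by (simp add: inner_sum_right mult.commute)
qed

text \<open>The image of \<open>M\<close> under a map of finite range is a finite combination of Dirac masses, for which the
  formula is linearity. Along maps that converge to the identity these images converge weak-* to
  \<open>M\<close>, so both sides pass to the limit: the left one by weak-* continuity of \<open>\<Phi>\<close>, the right one because
  the features are continuous.\<close>

lemma inner_measure_operator:
  fixes X :: "'a::euclidean_space set"
  assumes X: "compact X" "convex X" "X \<noteq> {}"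
    and op: "measure_operator X \<Phi>" and cont: "continuous_on X (feature X \<Phi>)"
    and M: "M \<in> nonneg_measures X"
  shows "g \<bullet> \<Phi> (measure M) = (\<integral>t. g \<bullet> feature X \<Phi> t \<partial>M)"
proof -
  interpret finite_measure M using M by (simp add: nonneg_measures_def)
  have s: "sets M = sets (borel_on X)" using M by (simp add: nonneg_measures_def)
  obtain q :: "nat \<Rightarrow> 'a \<Rightarrow> 'a" where q: "\<And>n. q n \<in> borel_on X \<rightarrow>\<^sub>M borel_on X" "\<And>n. finite (q n ` X)"
    "\<And>n t. t \<in> X \<Longrightarrow> q n t \<in> X" "\<And>t. t \<in> X \<Longrightarrow> (\<lambda>n. q n t) \<longlonglongrightarrow> t"
    using finite_range_approximation[OF compact_imp_closed[OF X(1)] X(2,3)] by blast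
  have qM: "q n \<in> M \<rightarrow>\<^sub>M borel_on X" for n using q(1) measurable_cong_sets[OF s refl] by blast
  let ?N = "\<lambda>n. distr M (borel_on X) (q n)"
  have N: "?N n \<in> nonneg_measures X" for n
    using finite_measure_distr[OF qM[of n]] by (simp add: nonneg_measures_def)
  have "(\<lambda>n. \<integral>t. f t \<partial>?N n) \<longlonglongrightarrow> (\<integral>t. f t \<partial>M)" if "continuous_on X f" for f :: "'a \<Rightarrow> real"
    using discretised_integral_tendsto[OF X(1) that M, of q] q
    by (simp add: integral_distr[OF qM continuous_on_borel_on[OF that]])
  from measure_operator_weak_limit[OF op M N this]
  have "(\<lambda>n. g \<bullet> \<Phi> (measure (?N n))) \<longlonglongrightarrow> g \<bullet> \<Phi> (measure M)" .
  moreover have "g \<bullet> \<Phi> (measure (?N n)) = (\<integral>t. g \<bullet> feature X \<Phi> (q n t) \<partial>M)" for n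
    unfolding discretised_feature_sum[OF op M q(1,2)]
      discretised_integral_sum[OF M q(1,2), of "\<lambda>t. g \<bullet> feature X \<Phi> t"] ..
  moreover have "(\<lambda>n. \<integral>t. g \<bullet> feature X \<Phi> (q n t) \<partial>M) \<longlonglongrightarrow> (\<integral>t. g \<bullet> feature X \<Phi> t \<partial>M)"
    by (rule discretised_integral_tendsto[OF X(1) _ M q(1,3,4)]) (intro continuous_intros cont)
  ultimately show ?thesis
    using LIMSEQ_unique by auto
qed

text \<open>The discretising maps do not depend on \<open>\<omega>\<close>, so the integral is a limit of finite linear
  combinations of evaluations of the random measure at fixed Borel sets.\<close>

lemma random_measure_integral_measurable:
  fixes X :: "'a::euclidean_space set" and f :: "'a \<Rightarrow> real"
  assumes X: "compact X" "convex X" "X \<noteq> {}"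
    and rm: "random_measure X G \<mu>" and f: "continuous_on X f"
  shows "(\<lambda>\<omega>. \<integral>t. f t \<partial>\<mu> \<omega>) \<in> borel_measurable G"
proof -
  obtain q :: "nat \<Rightarrow> 'a \<Rightarrow> 'a" where q: "\<And>n. q n \<in> borel_on X \<rightarrow>\<^sub>M borel_on X" "\<And>n. finite (q n ` X)"
    "\<And>n t. t \<in> X \<Longrightarrow> q n t \<in> X" "\<And>t. t \<in> X \<Longrightarrow> (\<lambda>n. q n t) \<longlonglongrightarrow> t"
    using finite_range_approximation[OF compact_imp_closed[OF X(1)] X(2,3)] by blast
  have mem: "\<mu> \<omega> \<in> nonneg_measures X" if "\<omega> \<in> space G" for \<omega>
    using rm that by (auto simp: random_measure_def)
  have sets: "q n -` {x} \<inter> X \<in> sets (borel_on X)" if "x \<in> q n ` X" for n x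
  proof -
    have "x \<in> X" using that q(3) by auto
    then have "{x} \<in> sets (borel_on X)"
      by (auto simp: sets_restrict_space intro!: image_eqI[of _ _ "{x}"])
    then show ?thesis using measurable_sets[OF q(1)] by (simp add: space_restrict_space)
  qed
  show ?thesis
  proof (rule borel_measurable_LIMSEQ_real)
    show "(\<lambda>n. \<integral>t. f (q n t) \<partial>\<mu> \<omega>) \<longlonglongrightarrow> (\<integral>t. f t \<partial>\<mu> \<omega>)" if "\<omega> \<in> space G" for \<omega>
      by (rule discretised_integral_tendsto[OF X(1) f mem[OF that] q(1,3,4)])
    fix n
    have "(\<lambda>\<omega>. \<Sum>x\<in>q n ` X. f x * measure (\<mu> \<omega>) (q n -` {x} \<inter> X)) \<in> borel_measurable G"
      using rm sets by (intro borel_measurable_sum borel_measurable_times borel_measurable_const)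
        (auto simp: random_measure_def)
    then show "(\<lambda>\<omega>. \<integral>t. f (q n t) \<partial>\<mu> \<omega>) \<in> borel_measurable G"
      by (subst measurable_cong[OF discretised_integral_sum[OF mem q(1,2)]])
  qed
qed

section \<open>Regularity of the features and volume of balls in the domain\<close>

text \<open>The derivative in \<open>s\<close> of \<open>k s t - k s t'\<close> is a difference of values of the derivative of \<open>k\<close>, which is
  Lipschitz because the second derivative is bounded on a compact convex set; the mean value
  inequality is applied once in each variable.\<close>

lemma C2_mixed_difference:
  fixes k :: "'a::euclidean_space \<Rightarrow> 'a \<Rightarrow> real"
  assumes X: "compact X" "convex X" and k: "C2_on (X \<times> X) (\<lambda>(s, t). k s t)"
  obtains b where "0 \<le> b"
    "\<And>s s' t t'. s \<in> X \<Longrightarrow> s' \<in> X \<Longrightarrow> t \<in> X \<Longrightarrow> t' \<in> X \<Longrightarrow>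
      \<bar>(k s t - k s t') - (k s' t - k s' t')\<bar> \<le> b * norm (s - s') * norm (t - t')"
proof -
  obtain f' :: "'a \<times> 'a \<Rightarrow> ('a \<times> 'a) \<Rightarrow>\<^sub>L real" and f'' :: "'a \<times> 'a \<Rightarrow> ('a \<times> 'a) \<Rightarrow>\<^sub>L (('a \<times> 'a) \<Rightarrow>\<^sub>L real)"
    where f': "\<And>x. x \<in> X \<times> X \<Longrightarrow> ((\<lambda>(s, t). k s t) has_derivative blinfun_apply (f' x)) (at x within X \<times> X)"
      and f'': "\<And>x. x \<in> X \<times> X \<Longrightarrow> (f' has_derivative blinfun_apply (f'' x)) (at x within X \<times> X)"
      and c: "continuous_on (X \<times> X) f''"
    using k unfolding C2_on_def by metis
  have "bounded (f'' ` (X \<times> X))"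
    by (intro compact_imp_bounded compact_continuous_image[OF c] compact_Times X)
  then obtain b where b: "0 < b" "\<And>x. x \<in> X \<times> X \<Longrightarrow> norm (f'' x) \<le> b"
    unfolding bounded_pos by auto
  have lip: "norm (f' x - f' x') \<le> b * norm (x - x')" if "x \<in> X \<times> X" "x' \<in> X \<times> X" for x x'
    using that f'' b(2)
    by (intro differentiable_bound[of "X \<times> X" f' "\<lambda>x. blinfun_apply (f'' x)"])
       (auto simp: norm_blinfun.rep_eq[symmetric] convex_Times X)
  show thesis
  proof
    show "0 \<le> b" using b by simp
    fix s s' t t' assume st: "s \<in> X" "s' \<in> X" "t \<in> X" "t' \<in> X"
    let ?h = "\<lambda>u. k u t - k u t'"
    let ?h' = "\<lambda>u v. f' (u, t) (v, 0) - f' (u, t') (v, 0)"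
    have partial: "((\<lambda>u. k u w) has_derivative (\<lambda>v. f' (u, w) (v, 0))) (at u within X)"
      if "u \<in> X" "w \<in> X" for u w
    proof -
      have "((\<lambda>u. (u, w)) has_derivative (\<lambda>v. (v, 0))) (at u within X)"
        by (intro derivative_eq_intros) auto
      moreover have "((\<lambda>(s, t). k s t) has_derivative blinfun_apply (f' (u, w)))
          (at (u, w) within (\<lambda>u. (u, w)) ` X)"
        by (rule has_derivative_subset[OF f']) (use that in auto)
      ultimately show ?thesis
        using has_derivative_in_compose[of "\<lambda>u. (u, w)" "\<lambda>v. (v, 0)" u X "\<lambda>(s, t). k s t"] by simp
    qed
    have "norm (?h s - ?h s') \<le> (b * norm (t - t')) * norm (s - s')"
    proof (rule differentiable_bound[OF X(2)])
      fix u assume u: "u \<in> X"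
      show "(?h has_derivative ?h' u) (at u within X)"
        by (intro has_derivative_diff partial u st)
      show "onorm (?h' u) \<le> b * norm (t - t')"
      proof (rule onorm_bound)
        show "0 \<le> b * norm (t - t')" using b by simp
        fix v :: 'a
        have "norm (?h' u v) = norm ((f' (u, t) - f' (u, t')) (v, 0))"
          by (simp add: blinfun.diff_left)
        also have "\<dots> \<le> norm (f' (u, t) - f' (u, t')) * norm (v, 0::'a)"
          by (rule norm_blinfun)
        also have "\<dots> \<le> (b * norm ((u, t) - (u, t'))) * norm (v, 0::'a)"
          using u st by (intro mult_right_mono lip) auto
        finally show "norm (?h' u v) \<le> b * norm (t - t') * norm v"
          by (simp add: norm_Pair)
      qed
    qed (use st in auto)
    then show "\<bar>?h s - ?h s'\<bar> \<le> b * norm (s - s') * norm (t - t')"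
      by (simp add: mult.commute mult.left_commute)
  qed
qed

text \<open>The squared distance of two features is a mixed second difference of the kernel, hence of second
  order in \<open>dist s t\<close>. A bound on the gradient of the kernel alone would only give Hoelder exponent
  \<open>1 / 2\<close>, and the exponent of the convergence rate depends on this Lipschitz property.\<close>

lemma feature_lipschitz_of_C2:
  fixes X :: "'a::euclidean_space set" and \<Phi> :: "('a set \<Rightarrow> real) \<Rightarrow> 'h::real_inner"
  assumes X: "compact X" "convex X"
    and k: "C2_on (X \<times> X) (\<lambda>(s, t). feature_kernel X \<Phi> s t)"
  obtains \<Lambda> where "0 < \<Lambda>"
    "\<And>s t. s \<in> X \<Longrightarrow> t \<in> X \<Longrightarrow> norm (feature X \<Phi> s - feature X \<Phi> t) \<le> \<Lambda> * dist s t"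
proof -
  obtain b where b: "0 \<le> b" "\<And>s s' t t'. s \<in> X \<Longrightarrow> s' \<in> X \<Longrightarrow> t \<in> X \<Longrightarrow> t' \<in> X \<Longrightarrow>
      \<bar>(feature_kernel X \<Phi> s t - feature_kernel X \<Phi> s t')
        - (feature_kernel X \<Phi> s' t - feature_kernel X \<Phi> s' t')\<bar> \<le> b * norm (s - s') * norm (t - t')"
    using C2_mixed_difference[OF X k] by metis
  show thesis
  proof
    show "0 < sqrt b + 1" using b(1) by (simp add: add_nonneg_pos)
    fix s t assume st: "s \<in> X" "t \<in> X"
    let ?f = "feature X \<Phi>"
    have "(norm (?f s - ?f t))\<^sup>2 = (?f s \<bullet> ?f s - ?f s \<bullet> ?f t) - (?f t \<bullet> ?f s - ?f t \<bullet> ?f t)"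
      by (simp add: power2_norm_eq_inner inner_diff_left inner_diff_right inner_commute)
    also have "\<dots> \<le> b * norm (s - t) * norm (s - t)"
      using b(2)[of s t s t] st unfolding feature_kernel_def by (auto dest: abs_le_D1)
    also have "\<dots> = (sqrt b * dist s t)\<^sup>2"
      using b(1) by (simp add: power_mult_distrib dist_norm power2_eq_square)
    finally have "norm (?f s - ?f t) \<le> sqrt b * dist s t"
      by (rule power2_le_imp_le) (use b(1) in auto)
    then show "norm (?f s - ?f t) \<le> (sqrt b + 1) * dist s t"
      by (simp add: distrib_right add_increasing2)
  qed
qed

text \<open>Shrinking a fixed inner ball of \<open>X\<close> towards a point \<open>x \<in> X\<close> by the factor \<open>r / D\<close> keeps it in
  \<open>X\<close> by convexity and moves it into the ball of radius \<open>r\<close> around \<open>x\<close>.\<close>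

lemma convex_cball_volume:
  fixes X :: "'a::euclidean_space set"
  assumes X: "compact X" "convex X" and ne: "interior X \<noteq> {}"
  obtains v D where "0 < v" "0 < D"
    "\<And>x r. x \<in> X \<Longrightarrow> 0 < r \<Longrightarrow> r \<le> D \<Longrightarrow> v * r ^ DIM('a) \<le> measure lborel (cball x r \<inter> X)"
proof -
  obtain p \<rho> where p: "0 < \<rho>" "ball p \<rho> \<subseteq> X"
    using ne by (meson ex_in_conv mem_interior)
  obtain D where D: "0 < D" "\<And>x z. x \<in> X \<Longrightarrow> z \<in> X \<Longrightarrow> dist x z \<le> D"
  proof
    show "0 < diameter X + 1" 
      using diameter_ge_0[OF compact_imp_bounded[OF X(1)]] by simp
    show "dist x z \<le> diameter X + 1" if "x \<in> X" "z \<in> X" for x z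
      using diameter_bounded_bound[OF compact_imp_bounded[OF X(1)] that] by simp
  qed
  show thesis
  proof
    show "0 < (\<rho> / D) ^ DIM('a) * measure lborel (ball (0::'a) 1)"
      using p D content_ball_pos[of 1 "0::'a"] by simp
    show "0 < D" by (rule D)
    fix x r assume x: "x \<in> X" and r: "0 < r" "r \<le> D"
    define s where "s = r / D"
    have s: "0 < s" "s \<le> 1" using r D by (simp_all add: s_def)
    let ?q = "(1 - s) *\<^sub>R x + s *\<^sub>R p"
    have sub: "ball ?q (s * \<rho>) \<subseteq> cball x r \<inter> X"
    proof
      fix z assume z: "z \<in> ball ?q (s * \<rho>)"
      define w where "w = p + (1 / s) *\<^sub>R (z - ?q)"
      have z_eq: "z = (1 - s) *\<^sub>R x + s *\<^sub>R w"
        using s by (simp add: w_def algebra_simps)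
      have "norm (z - ?q) < s * \<rho>" using z by (simp add: dist_norm norm_minus_commute)
      moreover have "dist p w = norm (z - ?q) / s"
        unfolding w_def dist_norm using s by simp
      ultimately have "dist p w < \<rho>"
        using s by (simp add: divide_less_eq mult.commute)
      then have w: "w \<in> X" using p by auto
      have "z \<in> X" unfolding z_eq using convexD[OF X(2) x w, of "1 - s" s] s by simp
      moreover have "x - z = s *\<^sub>R (x - w)" unfolding z_eq by (simp add: algebra_simps)
      then have "dist x z = s * dist x w" using s by (simp add: dist_norm)
      then have "dist x z \<le> r" using mult_left_mono[OF D(2)[OF x w], of s] s D(1) by (simp add: s_def)
      ultimately show "z \<in> cball x r \<inter> X" by simp
    qed
    have "(\<rho> / D) ^ DIM('a) * measure lborel (ball (0::'a) 1) * r ^ DIM('a) = measure lborel (ball ?q (s * \<rho>))"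
      unfolding content_ball_conv_unit_ball[OF less_imp_le[OF mult_pos_pos[OF s(1) p(1)]]]
      by (simp add: s_def power_mult_distrib power_divide)
    also have "\<dots> \<le> measure lborel (cball x r \<inter> X)"
      using sub by (intro measure_mono_fmeasurable) (auto intro!: fmeasurable_compact compact_Int_closed compact_imp_closed X)
    finally show "(\<rho> / D) ^ DIM('a) * measure lborel (ball (0::'a) 1) * r ^ DIM('a) \<le> measure lborel (cball x r \<inter> X)" .
  qed
qed

section \<open>The objective and its certificate\<close>

locale measure_problem =
  fixes X :: "'a::euclidean_space set" and \<Phi> :: "('a set \<Rightarrow> real) \<Rightarrow> 'h::real_inner"
    and y :: 'h and \<kappa> \<Lambda> :: real
  assumes compact_domain: "compact X" and convex_domain: "convex X" and nonempty_domain: "X \<noteq> {}"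
    and operator: "measure_operator X \<Phi>"
    and norm_feature: "t \<in> X \<Longrightarrow> norm (feature X \<Phi> t) = 1"
    and lipschitz_pos: "0 < \<Lambda>"
    and feature_lipschitz: "s \<in> X \<Longrightarrow> t \<in> X \<Longrightarrow> norm (feature X \<Phi> s - feature X \<Phi> t) \<le> \<Lambda> * dist s t"
    and \<kappa>_pos: "0 < \<kappa>"
begin

abbreviation "J \<equiv> objective X \<Phi> y \<kappa>"
abbreviation "J' \<equiv> certificate X \<Phi> y \<kappa>"

lemma continuous_feature: "continuous_on X (feature X \<Phi>)"
  unfolding continuous_on_iff
proof (intro ballI allI impI)
  fix x and e :: real assume x: "x \<in> X" and "0 < e"
  show "\<exists>d>0. \<forall>x'\<in>X. dist x' x < d \<longrightarrow> dist (feature X \<Phi> x') (feature X \<Phi> x) < e"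
  proof (intro exI[of _ "e / \<Lambda>"] conjI ballI impI)
    fix x' assume "x' \<in> X" "dist x' x < e / \<Lambda>"
    then show "dist (feature X \<Phi> x') (feature X \<Phi> x) < e"
      using feature_lipschitz[of x' x] x lipschitz_pos
      by (simp add: dist_norm[of "feature X \<Phi> x'"] field_simps)
  qed (simp add: \<open>0 < e\<close> lipschitz_pos)
qed

lemma inner_operator:
  "M \<in> nonneg_measures X \<Longrightarrow> g \<bullet> \<Phi> (measure M) = (\<integral>t. g \<bullet> feature X \<Phi> t \<partial>M)"
  by (rule inner_measure_operator[OF compact_domain convex_domain nonempty_domain operator
        continuous_feature])

lemma integral_const_domain:
  assumes "M \<in> nonneg_measures X"
  shows "(\<integral>t. c \<partial>M) = c * measure M X"
  using space_nonneg_measure[OF assms] assms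
  by (simp add: nonneg_measures_def finite_measure.emeasure_finite mult.commute)

text \<open>The representation of \<open>\<Phi>\<close> is tested against \<open>\<Phi> (measure M)\<close> itself; the features have norm 1.\<close>

lemma norm_operator_le:
  assumes M: "M \<in> nonneg_measures X"
  shows "norm (\<Phi> (measure M)) \<le> measure M X"
proof -
  let ?g = "\<Phi> (measure M)"
  interpret finite_measure M using M by (simp add: nonneg_measures_def)
  have "(norm ?g)\<^sup>2 = (\<integral>t. ?g \<bullet> feature X \<Phi> t \<partial>M)"
    by (simp add: power2_norm_eq_inner inner_operator[OF M])
  also have "\<dots> \<le> (\<integral>t. norm ?g \<partial>M)"
  proof (rule integral_mono)
    show "integrable M (\<lambda>t. ?g \<bullet> feature X \<Phi> t)"
      by (rule integrable_continuous_on[OF compact_domain _ M]) (intro continuous_intros continuous_feature)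
    show "?g \<bullet> feature X \<Phi> t \<le> norm ?g" if "t \<in> space M" for t
      using norm_cauchy_schwarz[of ?g "feature X \<Phi> t"] norm_feature that space_nonneg_measure[OF M] by simp
  qed simp
  also have "\<dots> = norm ?g * measure M X" by (rule integral_const_domain[OF M])
  finally have "norm ?g * norm ?g \<le> norm ?g * measure M X" by (simp add: power2_eq_square)
  then show ?thesis by (cases "?g = 0") auto
qed

lemma continuous_certificate: "continuous_on X (J' M)"
  unfolding certificate_def by (intro continuous_intros continuous_feature)

lemma certificate_lipschitz:
  assumes "s \<in> X" "t \<in> X"
  shows "\<bar>J' M s - J' M t\<bar> \<le> \<Lambda> * (norm (\<Phi> (measure M)) + norm y) * dist s t"
proof -
  have "\<bar>J' M s - J' M t\<bar> = \<bar>(feature X \<Phi> s - feature X \<Phi> t) \<bullet> (\<Phi> (measure M) - y)\<bar>"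
    by (simp add: certificate_def inner_diff_left)
  also have "\<dots> \<le> norm (feature X \<Phi> s - feature X \<Phi> t) * norm (\<Phi> (measure M) - y)"
    by (rule Cauchy_Schwarz_ineq2)
  also have "\<dots> \<le> (\<Lambda> * dist s t) * (norm (\<Phi> (measure M)) + norm y)"
    using assms lipschitz_pos
    by (intro mult_mono feature_lipschitz norm_triangle_ineq4) auto
  finally show ?thesis by (simp add: mult_ac)
qed

lemma certificate_bound:
  assumes "t \<in> X"
  shows "\<bar>J' M t\<bar> \<le> norm (\<Phi> (measure M)) + norm y + \<kappa>"
proof -
  have "\<bar>feature X \<Phi> t \<bullet> (\<Phi> (measure M) - y)\<bar> \<le> norm (\<Phi> (measure M) - y)"
    using Cauchy_Schwarz_ineq2[of "feature X \<Phi> t" "\<Phi> (measure M) - y"] norm_feature[OF assms] by simp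
  also have "\<dots> \<le> norm (\<Phi> (measure M)) + norm y" by (rule norm_triangle_ineq4)
  finally show ?thesis using \<kappa>_pos by (simp add: certificate_def)
qed

lemma certificate_measurable:
  assumes "random_measure X G \<mu>" "t \<in> X"
  shows "(\<lambda>\<omega>. J' (\<mu> \<omega>) t) \<in> borel_measurable G"
proof -
  have "(\<lambda>\<omega>. (\<integral>s. feature X \<Phi> t \<bullet> feature X \<Phi> s \<partial>\<mu> \<omega>) - feature X \<Phi> t \<bullet> y + \<kappa>) \<in> borel_measurable G"
    by (intro borel_measurable_add borel_measurable_diff borel_measurable_const
        random_measure_integral_measurable[OF compact_domain convex_domain nonempty_domain assms(1)]
        continuous_intros continuous_feature)
  also have "?this \<longleftrightarrow> ?thesis"
    using assms(1) by (intro measurable_cong)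
      (simp add: certificate_def inner_diff_right inner_operator random_measure_def)
  finally show ?thesis .
qed

lemma objective_nonneg: "M \<in> nonneg_measures X \<Longrightarrow> 0 \<le> J M"
  using \<kappa>_pos by (simp add: objective_def tv_norm_measure)

lemma objective_le:
  assumes M: "M \<in> nonneg_measures X" and m: "measure M X \<le> m" and "norm y \<le> c"
  shows "J M \<le> (c + m)\<^sup>2 / 2 + \<kappa> * m"
proof -
  have "norm (y - \<Phi> (measure M)) \<le> c + m"
    using norm_triangle_ineq4[of y "\<Phi> (measure M)"] norm_operator_le[OF M] assms by linarith
  then have "(norm (y - \<Phi> (measure M)))\<^sup>2 \<le> (c + m)\<^sup>2" by (intro power_mono) auto
  moreover have "\<kappa> * measure M X \<le> \<kappa> * m" using m \<kappa>_pos by simp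
  ultimately show ?thesis by (simp add: objective_def tv_norm_measure[OF M])
qed

text \<open>Convexity of the quadratic data term: the gap is at most the derivative of \<open>J\<close> at \<open>M\<close> in the
  direction \<open>M - N\<close>, which the certificate represents.\<close>

lemma objective_gap_le_certificate:
  assumes M: "M \<in> nonneg_measures X" and N: "N \<in> nonneg_measures X"
  shows "J M - J N \<le> (\<integral>t. J' M t \<partial>M) - (\<integral>t. J' M t \<partial>N)"
proof -
  let ?r = "\<Phi> (measure M) - y"
  have int: "(\<integral>t. J' M t \<partial>L) = ?r \<bullet> \<Phi> (measure L) + \<kappa> * measure L X" if L: "L \<in> nonneg_measures X" for L
  proof -
    interpret finite_measure L using L by (simp add: nonneg_measures_def)
    have i: "integrable L (\<lambda>t. ?r \<bullet> feature X \<Phi> t)"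
      by (rule integrable_continuous_on[OF compact_domain _ L]) (intro continuous_intros continuous_feature)
    have "(\<integral>t. J' M t \<partial>L) = (\<integral>t. ?r \<bullet> feature X \<Phi> t \<partial>L) + (\<integral>t. \<kappa> \<partial>L)"
      unfolding certificate_def inner_commute[of _ ?r] by (intro Bochner_Integration.integral_add i) simp
    then show ?thesis by (simp only: inner_operator[OF L] integral_const_domain[OF L])
  qed
  have "(norm ?r)\<^sup>2 / 2 - (norm (\<Phi> (measure N) - y))\<^sup>2 / 2
      = ?r \<bullet> (\<Phi> (measure M) - \<Phi> (measure N)) - (norm (\<Phi> (measure M) - \<Phi> (measure N)))\<^sup>2 / 2"
    by (simp add: power2_norm_eq_inner inner_diff_left inner_diff_right inner_commute field_simps)
  then have "(norm ?r)\<^sup>2 / 2 - (norm (\<Phi> (measure N) - y))\<^sup>2 / 2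
      \<le> ?r \<bullet> (\<Phi> (measure M) - \<Phi> (measure N))"
    by simp
  then show ?thesis
    by (simp add: objective_def tv_norm_measure M N int norm_minus_commute[of y] inner_diff_right
        right_diff_distrib)
qed

lemma integrable_certificate_square:
  assumes "M \<in> nonneg_measures X" shows "integrable M (\<lambda>t. (J' M t)\<^sup>2)"
  by (rule integrable_continuous_on[OF compact_domain _ assms]) (intro continuous_intros continuous_certificate)

lemma measure_norm_certificate_square:
  "(measure_norm M (J' M))\<^sup>2 = (\<integral>t. (J' M t)\<^sup>2 \<partial>M)"
  by (simp add: measure_norm_def)

text \<open>The first part of the gap is split by \<open>u \<le> \<eta> + u\<^sup>2 / \<eta>\<close>, so that the squared norm that the
  descent steps control enters linearly.\<close>

lemma objective_gap_bound:
  assumes M: "M \<in> nonneg_measures X" and N: "N \<in> nonneg_measures X"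
    and \<eta>: "0 < \<eta>" and \<sigma>: "\<And>t. t \<in> X \<Longrightarrow> - J' M t \<le> \<sigma>"
  shows "J M - J N \<le> \<eta> * measure M X + (measure_norm M (J' M))\<^sup>2 / \<eta> + \<sigma> * measure N X"
proof -
  interpret M: finite_measure M using M by (simp add: nonneg_measures_def)
  interpret N: finite_measure N using N by (simp add: nonneg_measures_def)
  have i: "integrable L (J' M)" if "L \<in> nonneg_measures X" for L
    by (rule integrable_continuous_on[OF compact_domain continuous_certificate that])
  have "J' M t \<le> \<eta> + (J' M t)\<^sup>2 / \<eta>" for t
  proof -
    have "J' M t * \<eta> \<le> \<eta>\<^sup>2 + (J' M t)\<^sup>2"
      using sum_squares_bound[of "J' M t" \<eta>] zero_le_power2[of \<eta>] zero_le_power2[of "J' M t"]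
      unfolding mult.assoc by linarith
    then show ?thesis using \<eta> by (simp add: field_simps power2_eq_square)
  qed
  then have "(\<integral>t. J' M t \<partial>M) \<le> (\<integral>t. \<eta> + (J' M t)\<^sup>2 / \<eta> \<partial>M)"
    using integrable_certificate_square[OF M] by (intro integral_mono i M) auto
  also have "\<dots> = \<eta> * measure M X + (measure_norm M (J' M))\<^sup>2 / \<eta>"
    using integrable_certificate_square[OF M]
    by (subst Bochner_Integration.integral_add)
       (auto simp: integral_const_domain[OF M] measure_norm_certificate_square simp del: lebesgue_integral_const)
  finally have 1: "(\<integral>t. J' M t \<partial>M) \<le> \<eta> * measure M X + (measure_norm M (J' M))\<^sup>2 / \<eta>" .
  have "(\<integral>t. - J' M t \<partial>N) \<le> (\<integral>t. \<sigma> \<partial>N)"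
    using \<sigma> space_nonneg_measure[OF N] by (intro integral_mono integrable_minus i N) auto
  then have "- (\<integral>t. J' M t \<partial>N) \<le> \<sigma> * measure N X"
    unfolding integral_const_domain[OF N] by simp
  then show ?thesis
    using 1 objective_gap_le_certificate[OF M N] by linarith
qed

lemma measure_norm_certificate_ge:
  assumes M: "M \<in> nonneg_measures X" and B: "B \<in> sets (borel_on X)"
    and w: "\<And>t. t \<in> B \<Longrightarrow> w \<le> (J' M t)\<^sup>2"
  shows "w * measure M B \<le> (measure_norm M (J' M))\<^sup>2"
proof -
  interpret M: finite_measure M using M by (simp add: nonneg_measures_def)
  have BM: "B \<in> sets M" using B M by (simp add: nonneg_measures_def)
  have "w * measure M B = (\<integral>t. w * indicator B t \<partial>M)"
    using sets.sets_into_space[OF BM] by (simp add: Int_absorb2)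
  also have "\<dots> \<le> (\<integral>t. (J' M t)\<^sup>2 \<partial>M)"
    using w BM by (intro integral_mono integrable_certificate_square M)
      (auto split: split_indicator simp: M.emeasure_finite less_top[symmetric])
  finally show ?thesis by (simp add: measure_norm_certificate_square)
qed

end

section \<open>Telescoping the descent steps\<close>

lemma hyp_TV_bound_nonneg:
  assumes "prob_space P" "hyp_TV X P \<nu> B"
    and "\<And>\<omega>. \<omega> \<in> space P \<Longrightarrow> \<nu> 0 \<omega> \<in> nonneg_measures X"
  shows "0 \<le> B"
proof -
  interpret prob_space P by fact
  have "AE \<omega> in P. tv_norm X (measure (\<nu> 0 \<omega>)) \<le> B"
    using assms(2) by (simp add: hyp_TV_def)
  then have "AE \<omega> in P. 0 \<le> B"
    using AE_space
  proof eventually_elim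
    case (elim \<omega>)
    from elim(1) show ?case
      unfolding tv_norm_measure[OF assms(3)[OF elim(2)]] by (rule order_trans[OF measure_nonneg])
  qed
  then show ?thesis by simp
qed

locale stochastic_descent = measure_problem X \<Phi> y \<kappa> \<Lambda> + prob_space P
  for X :: "'a::euclidean_space set" and \<Phi> :: "('a set \<Rightarrow> real) \<Rightarrow> 'h::real_inner"
    and y :: 'h and \<kappa> \<Lambda> :: real and P :: "'w measure" +
  fixes F Fp :: "nat \<Rightarrow> 'w measure" and \<nu> \<nu>p :: "nat \<Rightarrow> 'w \<Rightarrow> 'a measure"
    and \<alpha> c C a C\<^sub>P C\<^sub>T\<^sub>V :: real
  assumes filtrations: "interlaced_filtrations P F Fp"
    and random: "random_measure X (F k) (\<nu> k)" and random_plus: "random_measure X (Fp k) (\<nu>p k)"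
    and TV: "hyp_TV X P \<nu> C\<^sub>T\<^sub>V"
    and D: "hyp_D P F \<nu> \<nu>p (objective X \<Phi> y \<kappa>) (certificate X \<Phi> y \<kappa>) \<alpha> batch_size beta_schedule C"
    and birth: "hyp_birth X P Fp \<nu> \<nu>p (certificate X \<Phi> y \<kappa>) a batch_size (birth_rate \<alpha>) c C"
    and smooth1: "hyp_smooth1 P Fp \<nu> \<nu>p (objective X \<Phi> y \<kappa>) batch_size (birth_rate \<alpha>) C"
    and smooth2: "hyp_smooth2 X P \<nu> \<nu>p (certificate X \<Phi> y \<kappa>) (birth_rate \<alpha>) C"
    and \<alpha>_pos: "0 < \<alpha>" and \<alpha>_le: "\<alpha> \<le> 1" and c_pos: "0 < c" and C_pos: "0 < C"
    and y_bound: "norm y \<le> C\<^sub>P"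
begin

lemma subalgebra_F: "subalgebra P (F k)" and subalgebra_Fp: "subalgebra P (Fp k)"
  using filtrations by (auto simp: interlaced_filtrations_def)

lemma space_F: "space (F k) = space P" and space_Fp: "space (Fp k) = space P"
  using subalgebra_F subalgebra_Fp by (auto simp: subalgebra_def)

lemma cond_exp_F: "sigma_finite_subalgebra P (F k)" and cond_exp_Fp: "sigma_finite_subalgebra P (Fp k)"
  using subalgebra_F subalgebra_Fp finite_measure_axioms
  by (auto intro!: finite_measure_subalgebra_is_sigma_finite
      simp: finite_measure_subalgebra_def finite_measure_subalgebra_axioms_def)

lemma iterate_nonneg: "\<omega> \<in> space P \<Longrightarrow> \<nu> k \<omega> \<in> nonneg_measures X"
  using random[of k] by (auto simp: random_measure_def space_F)

lemma AE_mass_le: "AE \<omega> in P. measure (\<nu> k \<omega>) X \<le> C\<^sub>T\<^sub>V"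
  using TV[unfolded hyp_TV_def, rule_format, of k] AE_space
  by eventually_elim (simp add: tv_norm_measure[OF iterate_nonneg])

lemma C\<^sub>P_nonneg: "0 \<le> C\<^sub>P"
  using y_bound norm_ge_zero[of y] by linarith

lemma C\<^sub>T\<^sub>V_nonneg: "0 \<le> C\<^sub>T\<^sub>V"
  by (rule hyp_TV_bound_nonneg[OF prob_space_axioms TV iterate_nonneg])

definition J_max :: real where "J_max = (C\<^sub>P + C\<^sub>T\<^sub>V)\<^sup>2 / 2 + \<kappa> * C\<^sub>T\<^sub>V"

lemma J_max_nonneg: "0 \<le> J_max"
  using \<kappa>_pos C\<^sub>T\<^sub>V_nonneg by (simp add: J_max_def)

lemma AE_objective_le: "AE \<omega> in P. J (\<nu> k \<omega>) \<le> J_max"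
  using AE_mass_le[of k] AE_space
  by eventually_elim (simp add: objective_le iterate_nonneg y_bound J_max_def)

lemma integrable_objective_plus: "1 \<le> k \<Longrightarrow> integrable P (\<lambda>\<omega>. J (\<nu>p k \<omega>))"
  using D by (auto simp: hyp_D_def)

text \<open>This leaves out the first iterate, so that the telescoping sum below starts at index 2.\<close>

lemma integrable_objective:
  assumes "2 \<le> k"
  shows "integrable P (\<lambda>\<omega>. J (\<nu> k \<omega>))"
proof -
  obtain j where j: "k = Suc j" "1 \<le> j" using assms by (cases k) auto
  have "integrable P (\<lambda>\<omega>. (J (\<nu> (Suc j) \<omega>) - J (\<nu>p j \<omega>)) + J (\<nu>p j \<omega>))"
    using smooth1 j(2) integrable_objective_plus
    by (intro Bochner_Integration.integrable_add) (auto simp: hyp_smooth1_def)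
  then show ?thesis by (simp add: j)
qed

definition descent_error :: "nat \<Rightarrow> real" where
  "descent_error k = C * (\<alpha>\<^sup>2 / real (batch_size k) + (beta_schedule k)\<^sup>2
      + beta_schedule k / real (batch_size k))"

definition birth_error :: "nat \<Rightarrow> real" where
  "birth_error k = C * ((birth_rate \<alpha> k)\<^sup>2
      + birth_rate \<alpha> k * sqrt (ln (real (batch_size k)) / real (batch_size k)))"

text \<open>By the descent hypothesis this random variable dominates the squared norm of the certificate
  almost surely. It replaces that norm in all expectations: it is integrable, and its expectations
  telescope, whereas measurability of the norm would require an argument about the certificate
  as a function of the iterate and the position jointly.\<close>

definition decrease :: "nat \<Rightarrow> 'w \<Rightarrow> real" where
  "decrease k \<omega> = 2 / \<alpha> * (J (\<nu> k \<omega>) - real_cond_exp P (F k) (\<lambda>\<omega>. J (\<nu>p k \<omega>)) \<omega> + descent_error k)"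

lemma AE_certificate_le_decrease:
  assumes "1 \<le> k"
  shows "AE \<omega> in P. (measure_norm (\<nu> k \<omega>) (J' (\<nu> k \<omega>)))\<^sup>2 \<le> decrease k \<omega>"
proof -
  have "AE \<omega> in P. real_cond_exp P (F k) (\<lambda>\<omega>. J (\<nu>p k \<omega>)) \<omega> - J (\<nu> k \<omega>)
      \<le> - (\<alpha> / 2) * (measure_norm (\<nu> k \<omega>) (J' (\<nu> k \<omega>)))\<^sup>2 + descent_error k"
    using D assms unfolding hyp_D_def descent_error_def by blast
  then show ?thesis
    by eventually_elim (use \<alpha>_pos in \<open>simp add: decrease_def field_simps\<close>)
qed

lemma integrable_decrease: "2 \<le> k \<Longrightarrow> integrable P (decrease k)"
  unfolding decrease_def
  by (intro integrable_mult_right Bochner_Integration.integrable_add Bochner_Integration.integrable_diff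
      integrable_objective sigma_finite_subalgebra.real_cond_exp_int(1)[OF cond_exp_F]
      integrable_objective_plus) auto

lemma expectation_decrease_nonneg:
  assumes "1 \<le> k"
  shows "0 \<le> expectation (decrease k)"
proof (rule integral_nonneg_AE)
  show "AE \<omega> in P. 0 \<le> decrease k \<omega>"
    using AE_certificate_le_decrease[OF assms] by eventually_elim (rule order_trans[OF zero_le_power2])
qed

lemma expectation_decrease_le:
  assumes k: "2 \<le> k"
  shows "\<alpha> / 2 * expectation (decrease k)
    \<le> expectation (\<lambda>\<omega>. J (\<nu> k \<omega>)) - expectation (\<lambda>\<omega>. J (\<nu> (Suc k) \<omega>)) + descent_error k + birth_error k"
proof -
  let ?p = "\<lambda>\<omega>. J (\<nu>p k \<omega>)" and ?s = "\<lambda>\<omega>. J (\<nu> (Suc k) \<omega>)"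
  note ce = sigma_finite_subalgebra.real_cond_exp_int
  have ip: "integrable P ?p" using integrable_objective_plus k by simp
  have is_: "integrable P ?s" using integrable_objective k by simp
  have "expectation (decrease k) = 2 / \<alpha> * (expectation (\<lambda>\<omega>. J (\<nu> k \<omega>)) - expectation ?p + descent_error k)"
    unfolding decrease_def
    using integrable_objective[OF k] ce[OF cond_exp_F ip, of k]
    by (simp add: prob_space)
  moreover have "expectation ?s - expectation ?p \<le> birth_error k"
  proof -
    have id: "integrable P (\<lambda>\<omega>. ?s \<omega> - ?p \<omega>)" using ip is_ by simp
    have "expectation ?s - expectation ?p = expectation (\<lambda>\<omega>. ?s \<omega> - ?p \<omega>)"
      using ip is_ by simp
    also have "\<dots> = expectation (real_cond_exp P (Fp k) (\<lambda>\<omega>. ?s \<omega> - ?p \<omega>))"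
      by (rule ce(2)[OF cond_exp_Fp id, symmetric])
    also have "\<dots> \<le> expectation (\<lambda>\<omega>. birth_error k)"
      using smooth1 k unfolding hyp_smooth1_def birth_error_def[symmetric]
      by (intro integral_mono_AE ce(1)[OF cond_exp_Fp id]) auto
    finally show ?thesis by (simp add: prob_space)
  qed
  ultimately show ?thesis using \<alpha>_pos by simp
qed

lemma errors_le:
  assumes k: "2 \<le> k" "k \<le> K" and K: "1 \<le> ln (real K)"
  shows "descent_error k + birth_error k \<le> 5 * C * sqrt (ln (real K)) * (1 / real k)"
proof -
  let ?k = "real k"
  have k0: "1 \<le> ?k" using k by simp
  have s: "1 \<le> sqrt (ln (real K))" using K by simp
  have b: "batch_size k = k" "beta_schedule k = 1 / ?k" using k by (auto simp: batch_size_def beta_schedule_def)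
  have sq: "(1 / ?k)\<^sup>2 \<le> 1 / ?k" "1 / ?k / ?k \<le> 1 / ?k"
    using k0 by (auto simp: power2_eq_square field_simps)
  have "\<alpha>\<^sup>2 \<le> 1" using \<alpha>_pos \<alpha>_le by (simp add: power_le_one)
  then have "\<alpha>\<^sup>2 / ?k \<le> 1 / ?k" using k0 by (simp add: divide_right_mono)
  then have 1: "descent_error k \<le> C * (3 * (1 / ?k))"
    unfolding descent_error_def b using sq C_pos by (intro mult_left_mono) linarith+
  have e: "0 \<le> birth_rate \<alpha> k" "birth_rate \<alpha> k \<le> 1 / sqrt ?k"
    using \<alpha>_pos k by (auto simp: birth_rate_def)
  have "(birth_rate \<alpha> k)\<^sup>2 \<le> (1 / sqrt ?k)\<^sup>2" using e by (rule power_mono[rotated])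
  then have e2: "(birth_rate \<alpha> k)\<^sup>2 \<le> 1 / ?k" using k0 by (simp add: power_divide)
  have "ln ?k \<le> ln (real K)" using k by simp
  then have "sqrt (ln ?k / ?k) \<le> sqrt (ln (real K)) / sqrt ?k"
    using k0 by (simp add: real_sqrt_divide divide_right_mono)
  then have "birth_rate \<alpha> k * sqrt (ln ?k / ?k) \<le> 1 / sqrt ?k * (sqrt (ln (real K)) / sqrt ?k)"
    using e k0 by (intro mult_mono) auto
  also have "\<dots> = sqrt (ln (real K)) * (1 / ?k)" using k0 by (simp add: field_simps)
  finally have 2: "birth_error k \<le> C * (1 / ?k + sqrt (ln (real K)) * (1 / ?k))"
    unfolding birth_error_def b using e2 C_pos by (intro mult_left_mono add_mono) auto
  have "1 / ?k \<le> sqrt (ln (real K)) * (1 / ?k)" using mult_right_mono[OF s, of "1 / ?k"] k0 by simp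
  then have "C * (1 / ?k) \<le> C * (sqrt (ln (real K)) * (1 / ?k))"
    by (rule mult_left_mono) (use C_pos in simp)
  moreover have "C * (3 * (1 / ?k)) = 3 * (C * (1 / ?k))"
    and "C * (1 / ?k + sqrt (ln (real K)) * (1 / ?k)) = C * (1 / ?k) + C * (sqrt (ln (real K)) * (1 / ?k))"
    and "5 * C * sqrt (ln (real K)) * (1 / ?k) = 5 * (C * (sqrt (ln (real K)) * (1 / ?k)))"
    by (simp_all add: distrib_left mult.assoc)
  ultimately show ?thesis using 1 2 by linarith
qed

lemma sum_inverse_le_ln:
  "1 \<le> n \<Longrightarrow> (\<Sum>k=2..n. 1 / real k) \<le> ln (real n)"
proof (induction n rule: nat_induct_at_least)
  case (Suc n)
  have "ln (real n / real (Suc n)) \<le> real n / real (Suc n) - 1"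
    using Suc by (intro ln_le_minus_one) simp
  also have "\<dots> = - (1 / real (Suc n))" by (simp add: field_simps)
  finally have "1 / real (Suc n) \<le> ln (real (Suc n)) - ln (real n)"
    using Suc by (simp add: ln_div)
  then show ?case using Suc by simp
qed simp

lemma sum_expectation_decrease_le:
  assumes K: "2 \<le> K" "1 \<le> ln (real K)"
  shows "\<alpha> / 2 * (\<Sum>k=2..K. expectation (decrease k))
    \<le> (J_max + 5 * C) * (ln (real K) * sqrt (ln (real K)))"
proof -
  let ?E = "\<lambda>k. expectation (\<lambda>\<omega>. J (\<nu> k \<omega>))" and ?s = "sqrt (ln (real K))"
  have s: "1 \<le> ?s" using K by simp
  have "\<alpha> / 2 * (\<Sum>k=2..K. expectation (decrease k))
      \<le> (\<Sum>k=2..K. (?E k - ?E (Suc k)) + 5 * C * ?s * (1 / real k))"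
    unfolding sum_distrib_left
  proof (rule sum_mono)
    fix k assume "k \<in> {2..K}"
    then show "\<alpha> / 2 * expectation (decrease k) \<le> (?E k - ?E (Suc k)) + 5 * C * ?s * (1 / real k)"
      using expectation_decrease_le[of k] errors_le[of k K] K by auto
  qed
  also have "\<dots> = (?E 2 - ?E (Suc K)) + 5 * C * ?s * (\<Sum>k=2..K. 1 / real k)"
    using sum_Suc_diff[of 2 K "\<lambda>k. - ?E k"] K unfolding sum.distrib sum_distrib_left by simp
  also have "\<dots> \<le> J_max + 5 * C * ?s * ln (real K)"
  proof (intro add_mono mult_left_mono)
    have "?E 2 \<le> expectation (\<lambda>_. J_max)"
      by (intro integral_mono_AE integrable_objective AE_objective_le) auto
    moreover have "0 \<le> ?E (Suc K)"
      by (intro integral_nonneg_AE AE_I2 objective_nonneg iterate_nonneg)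
    ultimately show "?E 2 - ?E (Suc K) \<le> J_max" by (simp add: prob_space)
    show "(\<Sum>k=2..K. 1 / real k) \<le> ln (real K)" using K by (intro sum_inverse_le_ln) simp
  qed (use C_pos s in auto)
  also have "\<dots> \<le> (J_max + 5 * C) * (ln (real K) * ?s)"
  proof -
    have "1 * 1 \<le> ln (real K) * ?s" using K s by (intro mult_mono) auto
    then have "J_max * 1 \<le> J_max * (ln (real K) * ?s)" using J_max_nonneg by (intro mult_left_mono) auto
    then show ?thesis by (simp add: algebra_simps)
  qed
  finally show ?thesis .
qed

text \<open>The best gap is at most the gap of any single iterate, so one good index suffices. It is taken from
  the second half of the horizon, where the birth rate is of order \<open>1 / \<surd>K\<close> and the batch size of
  order \<open>K\<close>; that half still contains a fixed fraction of the terms of the telescoping sum.\<close>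

lemma exists_small_decrease:
  assumes K: "4 \<le> K" "1 \<le> ln (real K)"
  obtains k where "K div 2 \<le> k" "k < K"
    "expectation (decrease (Suc k)) \<le> 4 * (J_max + 5 * C) * (ln (real K) * sqrt (ln (real K))) / (\<alpha> * real K)"
proof -
  let ?S = "(J_max + 5 * C) * (ln (real K) * sqrt (ln (real K)))"
  let ?u = "4 * ?S / (\<alpha> * real K)"
  have "\<exists>k\<in>{K div 2..<K}. expectation (decrease (Suc k)) \<le> ?u"
  proof (rule ccontr)
    assume "\<not> ?thesis"
    then have gt: "?u < expectation (decrease (Suc k))" if "k \<in> {K div 2..<K}" for k
      using that not_le by blast
    have "real K / 2 * ?u \<le> real (card {K div 2..<K}) * ?u"
    proof (rule mult_right_mono)
      have "K \<le> 2 * card {K div 2..<K}" unfolding card_atLeastLessThan by linarith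
      then show "real K / 2 \<le> real (card {K div 2..<K})" by linarith
      show "0 \<le> ?u" using J_max_nonneg C_pos K \<alpha>_pos by simp
    qed
    also have "\<dots> < (\<Sum>k\<in>{K div 2..<K}. expectation (decrease (Suc k)))"
    proof -
      have "(\<Sum>k\<in>{K div 2..<K}. ?u) < (\<Sum>k\<in>{K div 2..<K}. expectation (decrease (Suc k)))"
        using gt K by (intro sum_strict_mono) auto
      then show ?thesis by simp
    qed
    also have "\<dots> = (\<Sum>k\<in>{Suc (K div 2)..<Suc K}. expectation (decrease k))"
      by (rule sum.shift_bounds_Suc_ivl[symmetric])
    also have "\<dots> \<le> (\<Sum>k=2..K. expectation (decrease k))"
      using K by (intro sum_mono2 expectation_decrease_nonneg) auto
    finally have "\<alpha> / 2 * (real K / 2 * ?u) < \<alpha> / 2 * (\<Sum>k=2..K. expectation (decrease k))"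
      using \<alpha>_pos by simp
    also have "\<dots> \<le> ?S" using K by (intro sum_expectation_decrease_le) auto
    finally show False using \<alpha>_pos K by (simp add: field_simps)
  qed
  then obtain k where "K div 2 \<le> k" "k < K" "expectation (decrease (Suc k)) \<le> ?u"
    by auto
  then show thesis using that[of k] unfolding mult.assoc by blast
qed

end

section \<open>Births where the certificate is negative\<close>

context stochastic_descent
begin

lemma AE_certificate_facts:
  assumes k: "1 \<le> k"
  shows "AE \<omega> in P. \<omega> \<in> space P"
    and "AE \<omega> in P. measure (\<nu> (Suc k) \<omega>) X \<le> C\<^sub>T\<^sub>V"
    and "AE \<omega> in P. \<forall>t\<in>X. \<bar>J' (\<nu> (Suc k) \<omega>) t - J' (\<nu>p k \<omega>) t\<bar> \<le> C * birth_rate \<alpha> k"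
    and "AE \<omega> in P. \<forall>t\<in>X. \<bar>J' (\<nu> (Suc k) \<omega>) t\<bar> \<le> C\<^sub>T\<^sub>V + C\<^sub>P + \<kappa>"
    and "AE \<omega> in P. \<forall>s\<in>X. \<forall>t\<in>X.
      \<bar>J' (\<nu> (Suc k) \<omega>) s - J' (\<nu> (Suc k) \<omega>) t\<bar> \<le> \<Lambda> * (C\<^sub>T\<^sub>V + C\<^sub>P) * dist s t"
    and "AE \<omega> in P. (measure_norm (\<nu> (Suc k) \<omega>) (J' (\<nu> (Suc k) \<omega>)))\<^sup>2 \<le> decrease (Suc k) \<omega>"
proof -
  show "AE \<omega> in P. \<omega> \<in> space P" by (rule AE_space)
  show "AE \<omega> in P. measure (\<nu> (Suc k) \<omega>) X \<le> C\<^sub>T\<^sub>V" by (rule AE_mass_le)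
  show "AE \<omega> in P. \<forall>t\<in>X. \<bar>J' (\<nu> (Suc k) \<omega>) t - J' (\<nu>p k \<omega>) t\<bar> \<le> C * birth_rate \<alpha> k"
    using smooth2 k by (simp add: hyp_smooth2_def)
  show "AE \<omega> in P. (measure_norm (\<nu> (Suc k) \<omega>) (J' (\<nu> (Suc k) \<omega>)))\<^sup>2 \<le> decrease (Suc k) \<omega>"
    by (rule AE_certificate_le_decrease) simp
  have n: "AE \<omega> in P. norm (\<Phi> (measure (\<nu> (Suc k) \<omega>))) + norm y \<le> C\<^sub>T\<^sub>V + C\<^sub>P"
    using AE_space AE_mass_le[of "Suc k"]
  proof eventually_elim
    case (elim \<omega>)
    then show ?case
      using norm_operator_le[OF iterate_nonneg[OF elim(1)], of "Suc k"] y_bound by linarith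
  qed
  show "AE \<omega> in P. \<forall>t\<in>X. \<bar>J' (\<nu> (Suc k) \<omega>) t\<bar> \<le> C\<^sub>T\<^sub>V + C\<^sub>P + \<kappa>"
    using n
  proof eventually_elim
    case (elim \<omega>)
    have "\<bar>J' (\<nu> (Suc k) \<omega>) t\<bar> \<le> C\<^sub>T\<^sub>V + C\<^sub>P + \<kappa>" if "t \<in> X" for t
      using certificate_bound[OF that, of "\<nu> (Suc k) \<omega>"] elim by linarith
    then show ?case by blast
  qed
  show "AE \<omega> in P. \<forall>s\<in>X. \<forall>t\<in>X.
      \<bar>J' (\<nu> (Suc k) \<omega>) s - J' (\<nu> (Suc k) \<omega>) t\<bar> \<le> \<Lambda> * (C\<^sub>T\<^sub>V + C\<^sub>P) * dist s t"
    using n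
  proof eventually_elim
    case (elim \<omega>)
    show ?case
    proof (intro ballI)
      fix s t assume st: "s \<in> X" "t \<in> X"
      have "\<Lambda> * (norm (\<Phi> (measure (\<nu> (Suc k) \<omega>))) + norm y) * dist s t \<le> \<Lambda> * (C\<^sub>T\<^sub>V + C\<^sub>P) * dist s t"
        using elim lipschitz_pos by (intro mult_right_mono mult_left_mono) auto
      with certificate_lipschitz[OF st]
      show "\<bar>J' (\<nu> (Suc k) \<omega>) s - J' (\<nu> (Suc k) \<omega>) t\<bar> \<le> \<Lambda> * (C\<^sub>T\<^sub>V + C\<^sub>P) * dist s t"
        by (rule order_trans)
    qed
  qed
qed

lemma cball_in_borel_on: "cball x r \<inter> X \<in> sets (borel_on X)"
  by (auto simp: sets_restrict_space intro!: image_eqI[of _ _ "cball x r"])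

text \<open>The place where the certificate is most negative depends on the iterate, whereas the birth
  hypothesis speaks of fixed Borel sets. A finite net of centres reduces the former to the latter:
  the index of the best centre is known at time \<open>k\<^sup>+\<close>, and on the event that it takes a given value the
  mass born in the ball around this centre contributes at least \<open>W / 4\<close> times itself to the squared
  norm of the next certificate. Weighting by \<open>W\<close>, the truncated square of the violation, rather than by
  an indicator saves a power of \<open>d\<^sub>0\<close> in the final rate.\<close>

lemma violation_bound:
  assumes k: "1 \<le> k" and d0: "0 < d0" and r: "0 < r"
    and Lr: "\<Lambda> * (C\<^sub>T\<^sub>V + C\<^sub>P) * r \<le> d0 / 4" and eps: "C * birth_rate \<alpha> k \<le> d0 / 4"
    and b: "\<And>x. x \<in> X \<Longrightarrow> b \<le> c * birth_rate \<alpha> k * measure lborel (cball x r \<inter> X)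
        - C * birth_rate \<alpha> k * real (batch_size k) powr (- a)"
  obtains W where "integrable P W" "\<And>\<omega>. 0 \<le> W \<omega>"
    "b * expectation W \<le> 4 * expectation (decrease (Suc k))"
    "AE \<omega> in P. \<forall>t\<in>X. - J' (\<nu> (Suc k) \<omega>) t \<le> 3 / 2 * d0 + W \<omega> / d0"
proof -
  obtain S where S: "finite S" "S \<subseteq> X" "X \<subseteq> (\<Union>x\<in>S. ball x r)"
    using seq_compact_imp_totally_bounded[of X] compact_domain r
    by (meson compact_imp_seq_compact)
  obtain h and n :: nat where h: "S = h ` {i. i < n}"
    using finite_imp_nat_seg_image_inj_on[OF S(1)] by metis
  have hX: "h i \<in> X" if "i < n" for i using that h S(2) by auto
  have n: "0 < n"
  proof (rule ccontr)
    assume "\<not> 0 < n"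
    then have "S = {}" using h by simp
    then show False using S(3) nonempty_domain by simp
  qed
  define B where "B i = cball (h i) r \<inter> X" for i
  have B: "B i \<in> sets (borel_on X)" for i unfolding B_def by (rule cball_in_borel_on)
  define v where "v i \<omega> = - J' (\<nu>p k \<omega>) (h i)" for i \<omega>
  define V where "V \<omega> = Max ((\<lambda>i. v i \<omega>) ` {..<n})" for \<omega>
  define sel where "sel \<omega> = (LEAST i. i < n \<and> v i \<omega> = V \<omega>)" for \<omega>
  \<comment> \<open>The truncation at \<open>d0\<close> absorbs the variation of the certificate over a ball and over one step.\<close>
  define W where "W \<omega> = (if d0 \<le> V \<omega> then (V \<omega>)\<^sup>2 else 0)" for \<omega>
  define Wi where "Wi i \<omega> = (if sel \<omega> = i then W \<omega> else 0)" for i \<omega>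
  define N where "N i \<omega> = measure (\<nu> (Suc k) \<omega>) (B i)" for i \<omega>
  have vV: "v i \<omega> \<le> V \<omega>" if "i < n" for i \<omega>
    unfolding V_def using that by (intro Max_ge) auto
  have "\<exists>i. i < n \<and> v i \<omega> = V \<omega>" for \<omega>
  proof -
    have "V \<omega> \<in> (\<lambda>i. v i \<omega>) ` {..<n}" unfolding V_def using n by (intro Max_in) auto
    then show ?thesis by auto
  qed
  from LeastI_ex[OF this] have sel: "sel \<omega> < n" "v (sel \<omega>) \<omega> = V \<omega>" for \<omega>
    unfolding sel_def by blast+
  have W0: "0 \<le> W \<omega>" for \<omega> by (simp add: W_def)
  have Wi0: "0 \<le> Wi i \<omega>" for i \<omega> by (simp add: Wi_def W0)
  have W_sum: "W \<omega> = (\<Sum>i<n. Wi i \<omega>)" for \<omega>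
    using sel(1) by (simp add: Wi_def)

  have v_meas: "v i \<in> borel_measurable (Fp k)" if "i < n" for i
    unfolding v_def[abs_def] using certificate_measurable[OF random_plus hX[OF that]] by simp
  then have V_meas: "V \<in> borel_measurable (Fp k)"
    unfolding V_def[abs_def] by (intro borel_measurable_Max) auto
  then have W_meas: "W \<in> borel_measurable (Fp k)"
    unfolding W_def[abs_def] by measurable
  have sel_meas: "sel \<in> Fp k \<rightarrow>\<^sub>M count_space UNIV"
    unfolding sel_def[abs_def]
  proof (rule measurable_Least)
    fix i
    show "Measurable.pred (Fp k) (\<lambda>\<omega>. i < n \<and> v i \<omega> = V \<omega>)"
    proof (cases "i < n")
      case True
      note [measurable] = v_meas[OF True] V_meas
      show ?thesis by measurable
    qed simp
  qed
  have Wi_meas: "Wi i \<in> borel_measurable (Fp k)" for i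
  proof -
    have "Measurable.pred (Fp k) (\<lambda>\<omega>. sel \<omega> = i)"
      using measurable_compose[OF sel_meas, of "\<lambda>j. j = i"] by simp
    then show ?thesis
      unfolding Wi_def[abs_def] by (intro measurable_If W_meas borel_measurable_const) (simp_all add: pred_def)
  qed
  have N_meas: "N i \<in> borel_measurable P" for i
  proof (rule measurable_from_subalg[OF subalgebra_F])
    show "N i \<in> borel_measurable (F (Suc k))"
      unfolding N_def[abs_def] using random[of "Suc k"] B[of i] by (simp add: random_measure_def)
  qed

  let ?e = "C * birth_rate \<alpha> k"
  let ?m = "C\<^sub>T\<^sub>V + C\<^sub>P + \<kappa> + ?e"
  have e0: "0 \<le> ?e" using C_pos \<alpha>_pos by (simp add: birth_rate_def)
  have m0: "0 \<le> ?m" using C\<^sub>T\<^sub>V_nonneg C\<^sub>P_nonneg \<kappa>_pos e0 by simp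
  note facts = AE_certificate_facts[OF k]

  have V_le: "AE \<omega> in P. V \<omega> \<le> ?m"
    using facts
  proof eventually_elim
    case (elim \<omega>)
    have "h (sel \<omega>) \<in> X" using hX sel by blast
    from elim(3)[rule_format, OF this] elim(4)[rule_format, OF this]
    have "\<bar>J' (\<nu> (Suc k) \<omega>) (h (sel \<omega>)) - J' (\<nu>p k \<omega>) (h (sel \<omega>))\<bar> \<le> ?e"
      "\<bar>J' (\<nu> (Suc k) \<omega>) (h (sel \<omega>))\<bar> \<le> C\<^sub>T\<^sub>V + C\<^sub>P + \<kappa>" .
    then have "v (sel \<omega>) \<omega> \<le> ?m" unfolding v_def by linarith
    then show ?case by (simp add: sel)
  qed
  have W_le: "AE \<omega> in P. W \<omega> \<le> ?m\<^sup>2"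
    using V_le by eventually_elim (use d0 in \<open>auto simp: W_def intro!: power_mono\<close>)
  have W_int: "integrable P W"
    by (rule integrable_const_bound[of _ "?m\<^sup>2"])
       (use W_le W0 measurable_from_subalg[OF subalgebra_Fp W_meas] in auto)
  have WiW: "Wi i \<omega> \<le> W \<omega>" for i \<omega> using W0 by (simp add: Wi_def)
  have Wi_int: "integrable P (Wi i)" for i
    by (rule Bochner_Integration.integrable_bound[OF W_int])
       (use WiW Wi0 W0 measurable_from_subalg[OF subalgebra_Fp Wi_meas] in auto)
  have N_le: "AE \<omega> in P. \<bar>N i \<omega>\<bar> \<le> C\<^sub>T\<^sub>V" for i
    using facts
  proof eventually_elim
    case (elim \<omega>)
    have M: "\<nu> (Suc k) \<omega> \<in> nonneg_measures X" by (rule iterate_nonneg[OF elim(1)])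
    then have "N i \<omega> \<le> measure (\<nu> (Suc k) \<omega>) X"
      unfolding N_def using B[of i]
      by (intro finite_measure.finite_measure_mono)
         (auto simp: nonneg_measures_def B_def space_in_borel_on)
    then show ?case using elim(2) by (simp add: N_def)
  qed
  have WN_int: "integrable P (\<lambda>\<omega>. Wi i \<omega> * N i \<omega>)" for i
  proof (rule Bochner_Integration.integrable_bound[OF integrable_mult_right[OF Wi_int, of C\<^sub>T\<^sub>V i]])
    show "(\<lambda>\<omega>. Wi i \<omega> * N i \<omega>) \<in> borel_measurable P"
      using N_meas measurable_from_subalg[OF subalgebra_Fp Wi_meas] by simp
    show "AE \<omega> in P. norm (Wi i \<omega> * N i \<omega>) \<le> norm (C\<^sub>T\<^sub>V * Wi i \<omega>)"
      using N_le[of i]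
    proof eventually_elim
      case (elim \<omega>)
      show ?case
        using mult_left_mono[OF elim Wi0[of i \<omega>]] Wi0[of i \<omega>] C\<^sub>T\<^sub>V_nonneg
        by (simp add: abs_mult mult.commute)
    qed
  qed

  have near: "V \<omega> - d0 / 2 \<le> - J' (\<nu> (Suc k) \<omega>) t \<and> V \<omega> - 3 / 4 * d0 \<le> - J' (\<nu>p k \<omega>) t"
    if lip: "\<forall>s\<in>X. \<forall>t\<in>X. \<bar>J' (\<nu> (Suc k) \<omega>) s - J' (\<nu> (Suc k) \<omega>) t\<bar> \<le> \<Lambda> * (C\<^sub>T\<^sub>V + C\<^sub>P) * dist s t"
      and s2: "\<forall>t\<in>X. \<bar>J' (\<nu> (Suc k) \<omega>) t - J' (\<nu>p k \<omega>) t\<bar> \<le> ?e"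
      and t: "t \<in> B (sel \<omega>)" for \<omega> t
  proof -
    let ?x = "h (sel \<omega>)"
    have x: "?x \<in> X" and tX: "t \<in> X" and dist: "dist ?x t \<le> r" using hX sel t by (auto simp: B_def)
    have "\<Lambda> * (C\<^sub>T\<^sub>V + C\<^sub>P) * dist ?x t \<le> \<Lambda> * (C\<^sub>T\<^sub>V + C\<^sub>P) * r"
      using dist lipschitz_pos C\<^sub>T\<^sub>V_nonneg C\<^sub>P_nonneg by (intro mult_left_mono) auto
    then have "\<bar>J' (\<nu> (Suc k) \<omega>) ?x - J' (\<nu> (Suc k) \<omega>) t\<bar> \<le> d0 / 4"
      using lip[rule_format, OF x tX] Lr by linarith
    moreover have "\<bar>J' (\<nu> (Suc k) \<omega>) ?x - J' (\<nu>p k \<omega>) ?x\<bar> \<le> d0 / 4"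
      "\<bar>J' (\<nu> (Suc k) \<omega>) t - J' (\<nu>p k \<omega>) t\<bar> \<le> d0 / 4"
      using s2[rule_format, OF x] s2[rule_format, OF tX] eps by linarith+
    moreover have "V \<omega> = - J' (\<nu>p k \<omega>) ?x" using sel(2)[of \<omega>] by (simp add: v_def)
    ultimately show ?thesis by linarith
  qed

  have lower: "b * expectation (Wi i) \<le> expectation (\<lambda>\<omega>. Wi i \<omega> * N i \<omega>)" if i: "i < n" for i
  proof -
    let ?cN = "real_cond_exp P (Fp k) (N i)"
    have "AE \<omega> in P. c * birth_rate \<alpha> k * measure lborel (B i \<inter> {t \<in> X. J' (\<nu>p k \<omega>) t < 0})
        - ?e * real (batch_size k) powr (- a) \<le> ?cN \<omega>"
      using birth B[of i] unfolding hyp_birth_def N_def by auto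
    with facts have "AE \<omega> in P. b * Wi i \<omega> \<le> Wi i \<omega> * ?cN \<omega>"
    proof eventually_elim
      case (elim \<omega>)
      show ?case
      proof (cases "Wi i \<omega> = 0")
        case False
        then have s: "sel \<omega> = i" and "d0 \<le> V \<omega>" by (auto simp: Wi_def W_def split: if_splits)
        have "J' (\<nu>p k \<omega>) t < 0" if t: "t \<in> B i" for t
          using near[OF elim(5,3) t[folded s]] d0 \<open>d0 \<le> V \<omega>\<close> by linarith
        then have "B i \<inter> {t \<in> X. J' (\<nu>p k \<omega>) t < 0} = cball (h i) r \<inter> X"
          by (auto simp: B_def)
        then have "b \<le> ?cN \<omega>" using elim(7) b[OF hX[OF i]] by simp
        then show ?thesis using Wi0[of i \<omega>] unfolding mult.commute[of b] by (rule mult_left_mono)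
      qed simp
    qed
    then have "expectation (\<lambda>\<omega>. b * Wi i \<omega>) \<le> expectation (\<lambda>\<omega>. Wi i \<omega> * ?cN \<omega>)"
      by (intro integral_mono_AE integrable_mult_right Wi_int
          sigma_finite_subalgebra.real_cond_exp_intg(1)[OF cond_exp_Fp WN_int Wi_meas N_meas])
    also have "\<dots> = expectation (\<lambda>\<omega>. Wi i \<omega> * N i \<omega>)"
      by (rule sigma_finite_subalgebra.real_cond_exp_intg(2)[OF cond_exp_Fp WN_int Wi_meas N_meas])
    finally show ?thesis by simp
  qed

  have "b * expectation W = (\<Sum>i<n. b * expectation (Wi i))"
    unfolding W_sum[abs_def] by (simp add: Wi_int sum_distrib_left)
  also have "\<dots> \<le> (\<Sum>i<n. expectation (\<lambda>\<omega>. Wi i \<omega> * N i \<omega>))"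
    by (intro sum_mono lower) simp
  also have "\<dots> = expectation (\<lambda>\<omega>. \<Sum>i<n. Wi i \<omega> * N i \<omega>)"
    by (simp add: WN_int)
  also have "\<dots> \<le> expectation (\<lambda>\<omega>. 4 * decrease (Suc k) \<omega>)"
  proof (rule integral_mono_AE)
    show "AE \<omega> in P. (\<Sum>i<n. Wi i \<omega> * N i \<omega>) \<le> 4 * decrease (Suc k) \<omega>"
      using facts
    proof eventually_elim
      case (elim \<omega>)
      let ?M = "\<nu> (Suc k) \<omega>"
      have M: "?M \<in> nonneg_measures X" by (rule iterate_nonneg[OF elim(1)])
      have "(\<Sum>i<n. Wi i \<omega> * N i \<omega>) = (\<Sum>i<n. if i = sel \<omega> then W \<omega> * N i \<omega> else 0)"
        by (intro sum.cong) (auto simp: Wi_def)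
      also have "\<dots> = W \<omega> * N (sel \<omega>) \<omega>" using sel(1)[of \<omega>] by simp
      also have "\<dots> \<le> 4 * (measure_norm ?M (J' ?M))\<^sup>2"
      proof -
        have "W \<omega> / 4 \<le> (J' ?M t)\<^sup>2" if t: "t \<in> B (sel \<omega>)" for t
        proof (cases "d0 \<le> V \<omega>")
          case True
          then have "V \<omega> / 2 \<le> - J' ?M t" using near[OF elim(5,3) t] by linarith
          then have "(V \<omega> / 2)\<^sup>2 \<le> (- J' ?M t)\<^sup>2" using True d0 by (intro power_mono) auto
          then show ?thesis using True by (simp add: W_def power_divide)
        qed (simp add: W_def)
        from measure_norm_certificate_ge[OF M B[of "sel \<omega>"] this]
        show ?thesis by (simp add: N_def)
      qed
      also have "\<dots> \<le> 4 * decrease (Suc k) \<omega>" using elim(6) by simp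
      finally show ?case .
    qed
  qed (use WN_int integrable_decrease[of "Suc k"] k in auto)
  finally have upper: "b * expectation W \<le> 4 * expectation (decrease (Suc k))" by simp

  have "AE \<omega> in P. \<forall>t\<in>X. - J' (\<nu> (Suc k) \<omega>) t \<le> 3 / 2 * d0 + W \<omega> / d0"
    using facts
  proof eventually_elim
    case (elim \<omega>)
    show ?case
    proof
      fix t assume t: "t \<in> X"
      obtain i where i: "i < n" "t \<in> ball (h i) r" using S(3) t h by blast
      have x: "h i \<in> X" using hX i by blast
      have "\<Lambda> * (C\<^sub>T\<^sub>V + C\<^sub>P) * dist (h i) t \<le> \<Lambda> * (C\<^sub>T\<^sub>V + C\<^sub>P) * r"
        using i lipschitz_pos C\<^sub>T\<^sub>V_nonneg C\<^sub>P_nonneg by (intro mult_left_mono) auto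
      then have "\<bar>J' (\<nu> (Suc k) \<omega>) (h i) - J' (\<nu> (Suc k) \<omega>) t\<bar> \<le> d0 / 4"
        using elim(5)[rule_format, OF x t] Lr by linarith
      moreover have "\<bar>J' (\<nu> (Suc k) \<omega>) (h i) - J' (\<nu>p k \<omega>) (h i)\<bar> \<le> d0 / 4"
        using elim(3)[rule_format, OF x] eps by linarith
      moreover have "- J' (\<nu>p k \<omega>) (h i) \<le> V \<omega>" using vV[OF i(1)] by (simp add: v_def)
      ultimately have "- J' (\<nu> (Suc k) \<omega>) t \<le> V \<omega> + d0 / 2" by linarith
      moreover have "V \<omega> \<le> d0 + W \<omega> / d0"
      proof (cases "d0 \<le> V \<omega>")
        case True
        then have "d0 * V \<omega> \<le> (V \<omega>)\<^sup>2" using d0 by (simp add: power2_eq_square mult_right_mono)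
        then have "V \<omega> \<le> W \<omega> / d0" using True d0 by (simp add: W_def field_simps)
        then show ?thesis using d0 by simp
      qed (simp add: W_def)
      ultimately show "- J' (\<nu> (Suc k) \<omega>) t \<le> 3 / 2 * d0 + W \<omega> / d0" by linarith
    qed
  qed
  with W_int W0 upper show thesis by (rule that)
qed

text \<open>The best gap includes the first iterate, whose objective may fail to be integrable; the expectation
  of a non-integrable \<open>best_gap\<close> is the default value \<open>0\<close>.\<close>

lemma expectation_best_gap_le:
  assumes j: "1 \<le> j" "j \<le> K" and le: "AE \<omega> in P. J (\<nu> j \<omega>) - J \<nu>star \<le> g \<omega>"
    and g: "integrable P g" and g0: "0 \<le> expectation g"
  shows "expectation (best_gap J \<nu> \<nu>star K) \<le> expectation g"
proof (cases "integrable P (best_gap J \<nu> \<nu>star K)")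
  case True
  have "best_gap J \<nu> \<nu>star K \<omega> \<le> J (\<nu> j \<omega>) - J \<nu>star" for \<omega>
    unfolding best_gap_def using j by (intro Min_le) auto
  then have "AE \<omega> in P. best_gap J \<nu> \<nu>star K \<omega> \<le> g \<omega>"
    by (intro eventually_mono[OF le]) (rule order_trans)
  then show ?thesis by (rule integral_mono_AE[OF True g])
qed (simp add: not_integrable_integral_eq g0)

lemma expectation_best_gap_nonneg:
  assumes "1 \<le> K" and star: "is_minimizer X \<Phi> y \<kappa> \<nu>star"
  shows "0 \<le> expectation (best_gap J \<nu> \<nu>star K)"
proof (rule integral_nonneg_AE, rule AE_I2)
  fix \<omega> assume "\<omega> \<in> space P"
  then show "0 \<le> best_gap J \<nu> \<nu>star K \<omega>"
    unfolding best_gap_def using assms iterate_nonneg[of \<omega>]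
    by (subst Min_ge_iff) (auto simp: is_minimizer_def)
qed

lemma expectation_best_gap_le_J_max:
  assumes "1 \<le> K" and star: "\<nu>star \<in> nonneg_measures X"
  shows "expectation (best_gap J \<nu> \<nu>star K) \<le> J_max"
proof -
  have "AE \<omega> in P. J (\<nu> 1 \<omega>) - J \<nu>star \<le> J_max"
    using AE_objective_le[of 1] by eventually_elim (use objective_nonneg[OF star] in linarith)
  from expectation_best_gap_le[OF _ assms(1) this] show ?thesis
    using J_max_nonneg by (simp add: prob_space)
qed

lemma expectation_best_gap_le_decrease:
  assumes k: "1 \<le> k" "k < K" and d0: "0 < d0" and r: "0 < r"
    and Lr: "\<Lambda> * (C\<^sub>T\<^sub>V + C\<^sub>P) * r \<le> d0 / 4" and eps: "C * birth_rate \<alpha> k \<le> d0 / 4"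
    and b: "0 < b" "\<And>x. x \<in> X \<Longrightarrow> b \<le> c * birth_rate \<alpha> k * measure lborel (cball x r \<inter> X)
        - C * birth_rate \<alpha> k * real (batch_size k) powr (- a)"
    and \<eta>: "0 < \<eta>" and star: "\<nu>star \<in> nonneg_measures X"
    and u: "expectation (decrease (Suc k)) \<le> u"
  shows "expectation (best_gap J \<nu> \<nu>star K)
    \<le> \<eta> * C\<^sub>T\<^sub>V + u / \<eta> + (3 / 2 * d0 + 4 * u / (b * d0)) * measure \<nu>star X"
proof -
  obtain W where W: "integrable P W" "\<And>\<omega>. 0 \<le> W \<omega>"
    "b * expectation W \<le> 4 * expectation (decrease (Suc k))"
    "AE \<omega> in P. \<forall>t\<in>X. - J' (\<nu> (Suc k) \<omega>) t \<le> 3 / 2 * d0 + W \<omega> / d0"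
    using violation_bound[OF k(1) d0 r Lr eps b(2)] by blast
  have di: "integrable P (decrease (Suc k))" using integrable_decrease k by simp
  define g where "g \<omega> = \<eta> * C\<^sub>T\<^sub>V + decrease (Suc k) \<omega> / \<eta> + (3 / 2 * d0 + W \<omega> / d0) * measure \<nu>star X" for \<omega>
  have g: "integrable P g" unfolding g_def using di W(1) by simp
  have Eg: "expectation g = \<eta> * C\<^sub>T\<^sub>V + expectation (decrease (Suc k)) / \<eta>
      + (3 / 2 * d0 + expectation W / d0) * measure \<nu>star X"
    unfolding g_def using di W(1) by (simp add: prob_space)
  have EW: "0 \<le> expectation W" using W(2) by (intro integral_nonneg_AE) auto
  have E0: "0 \<le> expectation (decrease (Suc k))" by (rule expectation_decrease_nonneg) simp
  have "AE \<omega> in P. J (\<nu> (Suc k) \<omega>) - J \<nu>star \<le> g \<omega>"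
    using W(4) AE_certificate_facts[OF k(1)]
  proof eventually_elim
    case (elim \<omega>)
    let ?M = "\<nu> (Suc k) \<omega>"
    have M: "?M \<in> nonneg_measures X" by (rule iterate_nonneg[OF elim(2)])
    have "J ?M - J \<nu>star \<le> \<eta> * measure ?M X + (measure_norm ?M (J' ?M))\<^sup>2 / \<eta>
        + (3 / 2 * d0 + W \<omega> / d0) * measure \<nu>star X"
      using elim(1) by (intro objective_gap_bound[OF M star \<eta>]) auto
    also have "\<dots> \<le> g \<omega>"
      unfolding g_def using elim(3,7) \<eta>
      by (intro add_mono mult_left_mono divide_right_mono order_refl) auto
    finally show ?case .
  qed
  from expectation_best_gap_le[OF _ _ this g]
  have "expectation (best_gap J \<nu> \<nu>star K) \<le> expectation g"
    using k \<eta> C\<^sub>T\<^sub>V_nonneg E0 EW d0 by (simp add: Eg)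
  also have "\<dots> \<le> \<eta> * C\<^sub>T\<^sub>V + u / \<eta> + (3 / 2 * d0 + 4 * u / (b * d0)) * measure \<nu>star X"
  proof -
    have "b * expectation W \<le> 4 * u" using W(3) u by linarith
    then have "expectation W / d0 \<le> 4 * u / (b * d0)" using b(1) d0 by (simp add: field_simps)
    then show ?thesis
      unfolding Eg using u \<eta> by (intro add_mono mult_right_mono divide_right_mono order_refl) auto
  qed
  finally show ?thesis .
qed

end

section \<open>Choice of scales\<close>

definition rate :: "nat \<Rightarrow> real \<Rightarrow> nat \<Rightarrow> real" where
  "rate d \<alpha> K = \<alpha> powr (- 1 / 2) * ((ln (real K)) ^ 3 / real K) powr (1 / (2 * (2 + real d)))"

text \<open>These bounds are all that is used of the rate: it dominates the birth rate, its \<open>d\<close>-th power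
  (the volume of a ball) dominates the sampling noise of the births, and its power \<open>d + 2\<close> dominates
  the mean decrease up to the factor \<open>1 / \<surd>K\<close>. The last exponent is where \<open>1 / (2 (2 + d))\<close> comes from, and
  it is at least \<open>2\<close>, so the factor \<open>\<alpha> powr (- 1 / 2)\<close> compensates the \<open>1 / \<alpha>\<close> of the mean decrease.\<close>

lemma rate_bounds:
  assumes \<alpha>: "0 < \<alpha>" "\<alpha> \<le> 1" and K: "1 \<le> ln (real K)"
  shows "0 < rate d \<alpha> K"
    and "1 / sqrt (real K) \<le> rate d \<alpha> K"
    and "(1 / real K) powr (real d / (2 * (2 + real d))) \<le> rate d \<alpha> K ^ d"
    and "ln (real K) * sqrt (ln (real K)) / (\<alpha> * sqrt (real K)) \<le> rate d \<alpha> K ^ (2 + d)"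
proof -
  let ?p = "1 / (2 * (2 + real d))" and ?x = "(ln (real K)) ^ 3 / real K"
  have K1: "1 \<le> real K" using K by (cases "K = 0") auto
  have l3: "1 \<le> (ln (real K)) ^ 3" using K by simp
  have x: "0 < ?x" "1 / real K \<le> ?x" 
    using K1 less_le_trans[OF zero_less_one l3] divide_right_mono[OF l3, of "real K"] by simp_all
  have p: "0 < ?p" "?p \<le> 1 / 2" by (auto simp: field_simps)
  have A: "1 \<le> \<alpha> powr (- 1 / 2)"
    using powr_mono2'[of "- 1 / 2" \<alpha> 1] \<alpha> by simp
  show pos: "0 < rate d \<alpha> K" unfolding rate_def using \<alpha> x(1) K1 by (intro mult_pos_pos) auto
  have ge: "(1 / real K) powr ?p \<le> rate d \<alpha> K"
  proof -
    have "1 * (1 / real K) powr ?p \<le> \<alpha> powr (- 1 / 2) * ?x powr ?p"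
      using x p K1 A by (intro mult_mono powr_mono2) auto
    then show ?thesis by (simp add: rate_def)
  qed
  have "1 / sqrt (real K) = (1 / real K) powr (1 / 2)"
    using K1 by (simp add: powr_half_sqrt real_sqrt_divide)
  also have "\<dots> \<le> (1 / real K) powr ?p"
    using K1 p by (intro powr_mono') auto
  finally show "1 / sqrt (real K) \<le> rate d \<alpha> K" using ge by linarith
  have "(1 / real K) powr (real d / (2 * (2 + real d))) = ((1 / real K) powr ?p) ^ d"
    using K1 by (simp add: powr_power)
  also have "\<dots> \<le> rate d \<alpha> K ^ d" by (intro power_mono ge) simp
  finally show "(1 / real K) powr (real d / (2 * (2 + real d))) \<le> rate d \<alpha> K ^ d" .
  have "rate d \<alpha> K ^ (2 + d) = (\<alpha> powr (- 1 / 2)) ^ (2 + d) * (?x powr ?p) ^ (2 + d)"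
    unfolding rate_def by (rule power_mult_distrib)
  also have "(?x powr ?p) ^ (2 + d) = ?x powr (1 / 2)"
  proof -
    have "(?x powr ?p) ^ (2 + d) = ?x powr (?p * real (2 + d))"
      using x(1) by (simp only: powr_realpow[symmetric] powr_powr powr_gt_zero)
    also have "?p * real (2 + d) = 1 / 2" by (simp add: field_simps)
    finally show ?thesis .
  qed
  also have "?x powr (1 / 2) = ln (real K) * sqrt (ln (real K)) / sqrt (real K)"
  proof -
    have "sqrt ((ln (real K)) ^ 3) = ln (real K) * sqrt (ln (real K))"
      using K by (simp add: power3_eq_cube real_sqrt_mult)
    then show ?thesis using x by (simp add: powr_half_sqrt real_sqrt_divide)
  qed
  also have "(\<alpha> powr (- 1 / 2)) ^ (2 + d) = \<alpha> powr (- 1 / 2 * real (2 + d))"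
    using \<alpha> by (subst powr_power) (auto simp: mult.commute)
  finally have eq: "rate d \<alpha> K ^ (2 + d)
      = \<alpha> powr (- 1 / 2 * real (2 + d)) * (ln (real K) * sqrt (ln (real K)) / sqrt (real K))" .
  have "1 / \<alpha> = \<alpha> powr (- 1)" using \<alpha> by (simp add: powr_minus_divide)
  also have "\<dots> \<le> \<alpha> powr (- 1 / 2 * real (2 + d))" using \<alpha> by (intro powr_mono') auto
  finally have "1 / \<alpha> * (ln (real K) * sqrt (ln (real K)) / sqrt (real K)) \<le> rate d \<alpha> K ^ (2 + d)"
    unfolding eq using K by (intro mult_right_mono) auto
  then show "ln (real K) * sqrt (ln (real K)) / (\<alpha> * sqrt (real K)) \<le> rate d \<alpha> K ^ (2 + d)"
    by (simp add: field_simps)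
qed

lemma birth_rate_bounds:
  assumes "0 < \<alpha>" and K: "2 \<le> K" "4 / \<alpha>\<^sup>2 \<le> real K" and k: "K div 2 \<le> k" "k < K"
  shows "1 / sqrt (real K) \<le> birth_rate \<alpha> k" and "birth_rate \<alpha> k \<le> 2 / sqrt (real K)"
proof -
  have k1: "1 \<le> k" using K k by linarith
  have K4: "real K \<le> 4 * real k" using K k by linarith
  have "4 \<le> (\<alpha> * sqrt (real K))\<^sup>2"
    using K assms(1) by (simp add: power_mult_distrib field_simps)
  then have "2\<^sup>2 \<le> (\<alpha> * sqrt (real K))\<^sup>2" by simp
  then have "2 \<le> \<alpha> * sqrt (real K)" by (rule power2_le_imp_le) (use assms(1) in simp)
  then have "1 / sqrt (real K) \<le> \<alpha>" using K by (simp add: field_simps)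
  moreover have "1 / sqrt (real K) \<le> 1 / sqrt (real k)"
    using k k1 by (intro divide_left_mono) auto
  ultimately show "1 / sqrt (real K) \<le> birth_rate \<alpha> k"
    using k1 by (simp add: birth_rate_def)
  have "sqrt (real K) \<le> sqrt (4 * real k)" using K4 by simp
  also have "\<dots> = 2 * sqrt (real k)" by (simp add: real_sqrt_mult)
  finally have "1 / sqrt (real k) \<le> 2 / sqrt (real K)" using k1 K by (simp add: field_simps)
  then show "birth_rate \<alpha> k \<le> 2 / sqrt (real K)"
    using k1 by (simp add: birth_rate_def)
qed

context stochastic_descent
begin

text \<open>The violation threshold is \<open>d\<^sub>0 = b R\<close> with \<open>R\<close> the claimed rate. The mass born in a ball of
  radius proportional to \<open>R\<close> is of order \<open>R\<^sup>d / \<surd>K\<close>, so the violation part of the gap is of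
  order \<open>u \<surd>K / R\<^sup>d\<^sup>+\<^sup>1\<close> with \<open>u\<close> the mean decrease, and \<open>u \<le> A R\<^sup>d\<^sup>+\<^sup>2 / \<surd>K\<close>: the exponent of the rate is
  the one that balances this against \<open>R\<close>. When \<open>R\<close> is not small, the ball may exceed the scale \<open>D\<close> up to
  which the volume bound holds, but then a constant bound on the gap suffices.\<close>

lemma expectation_best_gap_rate:
  fixes K :: nat and v D L b R\<^sub>1 :: real
  assumes vol: "0 < v" "0 < D"
      "\<And>x r. x \<in> X \<Longrightarrow> 0 < r \<Longrightarrow> r \<le> D \<Longrightarrow> v * r ^ DIM('a) \<le> measure lborel (cball x r \<inter> X)"
    and a: "real DIM('a) / (2 * (2 + real DIM('a))) \<le> a"
    and L: "0 < L" "\<Lambda> * (C\<^sub>T\<^sub>V + C\<^sub>P) \<le> L"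
    and b: "4 * L \<le> b" "8 * C \<le> b" "16 * C * L / (c * v) \<le> b"
    and R\<^sub>1: "0 < R\<^sub>1" "R\<^sub>1 \<le> 1" "R\<^sub>1 \<le> 4 * L * D / b"
    and star: "\<nu>star \<in> nonneg_measures X"
    and K: "4 / \<alpha>\<^sup>2 \<le> real K"
  shows "expectation (best_gap J \<nu> \<nu>star K)
    \<le> (J_max / R\<^sub>1 + C\<^sub>T\<^sub>V + 4 * (J_max + 5 * C)
        + (3 / 2 * b + 4 * (4 * (J_max + 5 * C)) * 2 / (c * v * b)) * measure \<nu>star X) * rate DIM('a) \<alpha> K"
proof -
  let ?d = "DIM('a)"
  define R where "R = rate ?d \<alpha> K"
  define A where "A = 4 * (J_max + 5 * C)"
  have b0: "0 < b" using L b by linarith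
  have A0: "0 \<le> A" using J_max_nonneg C_pos by (simp add: A_def)
  have M0: "0 \<le> measure \<nu>star X" by simp
  have "4 \<le> 4 / \<alpha>\<^sup>2" using \<alpha>_pos \<alpha>_le by (simp add: field_simps power_le_one)
  then have K4: "4 \<le> K" using K by linarith
  have lnK: "1 \<le> ln (real K)"
  proof -
    have "exp 1 \<le> (3::real)" by (rule exp_le)
    also have "\<dots> \<le> real K" using K4 by simp
    finally show ?thesis using K4 by (subst ln_ge_iff) auto
  qed
  note rb = rate_bounds[OF \<alpha>_pos \<alpha>_le lnK, of ?d, folded R_def]
  have rest0: "0 \<le> C\<^sub>T\<^sub>V + A + (3 / 2 * b + 4 * A * 2 / (c * v * b)) * measure \<nu>star X"
    using C\<^sub>T\<^sub>V_nonneg A0 b0 c_pos vol(1) by simp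
  have "expectation (best_gap J \<nu> \<nu>star K)
    \<le> (J_max / R\<^sub>1 + (C\<^sub>T\<^sub>V + A + (3 / 2 * b + 4 * A * 2 / (c * v * b)) * measure \<nu>star X)) * R"
  proof (cases "R \<le> R\<^sub>1")
    case False
    have "expectation (best_gap J \<nu> \<nu>star K) \<le> J_max"
      using K4 by (intro expectation_best_gap_le_J_max star) simp
    also have "\<dots> \<le> J_max / R\<^sub>1 * R"
      using mult_left_mono[of R\<^sub>1 R "J_max / R\<^sub>1"] False R\<^sub>1 J_max_nonneg by simp
    also have "\<dots> \<le> (J_max / R\<^sub>1 + (C\<^sub>T\<^sub>V + A + (3 / 2 * b + 4 * A * 2 / (c * v * b)) * measure \<nu>star X)) * R"
      using rest0 rb(1) by (intro mult_right_mono) auto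
    finally show ?thesis .
  next
    case True
    obtain k where k: "K div 2 \<le> k" "k < K"
      and dec: "expectation (decrease (Suc k)) \<le> A * (ln (real K) * sqrt (ln (real K))) / (\<alpha> * real K)"
      using exists_small_decrease[OF K4 lnK] unfolding A_def by blast
    have k1: "1 \<le> k" using K4 k by linarith
    note eb = birth_rate_bounds[OF \<alpha>_pos _ K k]
    define s where "s = sqrt (real K)"
    have s1: "1 \<le> s" using K4 by (simp add: s_def)
    have ss: "real K = s * s" by (simp add: s_def)
    define u where "u = A * R ^ (2 + ?d) / s"
    define r where "r = b * R / (4 * L)"
    define m where "m = 1 / s * (c * v / 2) * R ^ ?d"
    have Rr: "R \<le> r" "0 < r"
      using mult_right_mono[OF b(1), of R] rb(1) L b0 by (auto simp: r_def field_simps)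
    have u: "expectation (decrease (Suc k)) \<le> u"
    proof -
      have "A * (ln (real K) * sqrt (ln (real K))) / (\<alpha> * real K)
          = A * (ln (real K) * sqrt (ln (real K)) / (\<alpha> * s)) / s"
        by (simp add: ss)
      also have "\<dots> \<le> u"
        unfolding u_def using rb(4) A0 s1 by (intro divide_right_mono mult_left_mono) (auto simp: s_def)
      finally show ?thesis using dec by linarith
    qed
    have rD: "r \<le> D"
    proof -
      have "b * R \<le> b * (4 * L * D / b)" using True R\<^sub>1 b0 by (intro mult_left_mono) auto
      then show ?thesis using b0 L by (simp add: r_def field_simps)
    qed
    have e0: "0 \<le> birth_rate \<alpha> k" using eb(1) K4 s1 by (simp add: s_def order_trans[rotated])
    have noise: "C * real (batch_size k) powr (- a) \<le> c * v / 2 * r ^ ?d"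
    proof -
      let ?q = "real ?d / (2 * (2 + real ?d))"
      have q: "0 \<le> ?q" "?q \<le> 1 / 2" by (auto simp: field_simps)
      have "real (batch_size k) powr (- a) \<le> real k powr (- ?q)"
        using k1 a by (auto simp: batch_size_def max_def intro!: powr_mono)
      also have "\<dots> = (1 / real k) powr ?q"
        using k1 by (simp add: powr_minus_divide powr_divide)
      also have "\<dots> \<le> (4 * (1 / real K)) powr ?q"
      proof (intro powr_mono2 q)
        have "real K \<le> 4 * real k" using K4 k by linarith
        then show "1 / real k \<le> 4 * (1 / real K)" using k1 K4 by (simp add: field_simps)
      qed simp
      also have "\<dots> = 4 powr ?q * (1 / real K) powr ?q" by (rule powr_mult)
      also have "\<dots> \<le> 4 powr (1 / 2) * R ^ ?d"
        using q rb(3) by (intro mult_mono powr_mono) auto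
      finally have 1: "real (batch_size k) powr (- a) \<le> 2 * R ^ ?d"
        by (simp add: powr_half_sqrt)
      have "16 * C * L \<le> b * (c * v)" using b(3) c_pos vol(1) by (simp add: field_simps)
      then have 2: "2 * C \<le> c * v / 2 * (b / (4 * L))" using L by (simp add: field_simps)
      have "b / (4 * L) \<le> (b / (4 * L)) ^ ?d"
        using b(1) L DIM_positive[where 'a='a] by (intro self_le_power) auto
      then have "c * v / 2 * (b / (4 * L)) \<le> c * v / 2 * (b / (4 * L)) ^ ?d"
        using c_pos vol(1) by (intro mult_left_mono) auto
      then have "2 * C \<le> c * v / 2 * (b / (4 * L)) ^ ?d" using 2 by linarith
      then have "2 * C * R ^ ?d \<le> c * v / 2 * (b / (4 * L)) ^ ?d * R ^ ?d"
        using rb(1) by (intro mult_right_mono) auto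
      also have "\<dots> = c * v / 2 * r ^ ?d"
        unfolding r_def by (simp add: power_mult_distrib power_divide)
      finally have "C * (2 * R ^ ?d) \<le> c * v / 2 * r ^ ?d" by (simp only: mult_ac)
      then show ?thesis by (rule order_trans[OF mult_left_mono[OF 1 less_imp_le[OF C_pos]]])
    qed
    have m0: "0 < m" using s1 c_pos vol(1) rb(1) by (simp add: m_def)
    \<comment> \<open>\<open>m\<close> is a lower bound for the expected mass born in a ball of radius \<open>r\<close>, net of sampling noise.\<close>
    have main: "expectation (best_gap J \<nu> \<nu>star K)
        \<le> R * C\<^sub>T\<^sub>V + u / R + (3 / 2 * (b * R) + 4 * u / (m * (b * R))) * measure \<nu>star X"
    proof (rule expectation_best_gap_le_decrease[OF k1 k(2) _ Rr(2) _ _ m0 _ rb(1) star u])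
      show "0 < b * R" using b0 rb(1) by simp
      have "\<Lambda> * (C\<^sub>T\<^sub>V + C\<^sub>P) * r \<le> L * r" using L Rr by (intro mult_right_mono) auto
      also have "\<dots> = b * R / 4" using L by (simp add: r_def)
      finally show "\<Lambda> * (C\<^sub>T\<^sub>V + C\<^sub>P) * r \<le> b * R / 4" .
      have "birth_rate \<alpha> k \<le> 2 * R" using eb(2) rb(2) K4 by simp
      then have "C * birth_rate \<alpha> k \<le> C * (2 * R)" using C_pos by (intro mult_left_mono) auto
      also have "\<dots> \<le> b * R / 4" using mult_right_mono[OF b(2), of R] rb(1) by simp
      finally show "C * birth_rate \<alpha> k \<le> b * R / 4" .
      fix x assume x: "x \<in> X"
      have "m \<le> birth_rate \<alpha> k * (c * v / 2 * r ^ ?d)"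
        unfolding m_def mult.assoc using eb(1) K4 c_pos vol(1) rb(1) Rr e0
        by (intro mult_mono power_mono) (auto simp: s_def)
      also have "\<dots> \<le> birth_rate \<alpha> k * (c * (v * r ^ ?d) - C * real (batch_size k) powr (- a))"
        using noise e0 by (intro mult_left_mono) auto
      also have "\<dots> \<le> birth_rate \<alpha> k * (c * measure lborel (cball x r \<inter> X) - C * real (batch_size k) powr (- a))"
        using vol(3)[OF x Rr(2) rD] c_pos e0 by (intro mult_left_mono diff_right_mono) auto
      finally show "m \<le> c * birth_rate \<alpha> k * measure lborel (cball x r \<inter> X)
          - C * birth_rate \<alpha> k * real (batch_size k) powr (- a)"
        by (simp add: algebra_simps)
    qed
    have "u / R \<le> A * R"
    proof -
      have "R ^ ?d \<le> 1" using rb(1) True R\<^sub>1 by (intro power_le_one) auto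
      then have "R ^ ?d * R / s \<le> 1 * R / 1" using rb(1) s1 by (intro frac_le mult_right_mono) auto
      then have "A * (R ^ ?d * R / s) \<le> A * R" using A0 by (intro mult_left_mono) auto
      moreover have "u / R = A * (R ^ ?d * R / s)" using rb(1) by (simp add: u_def power_add power2_eq_square)
      ultimately show ?thesis by simp
    qed
    moreover have "4 * u / (m * (b * R)) = 4 * A * 2 / (c * v * b) * R"
      using rb(1) s1 b0 c_pos vol(1) by (simp add: u_def m_def power_add power2_eq_square field_simps)
    ultimately have "expectation (best_gap J \<nu> \<nu>star K)
        \<le> (C\<^sub>T\<^sub>V + A + (3 / 2 * b + 4 * A * 2 / (c * v * b)) * measure \<nu>star X) * R"
      using main by (simp add: algebra_simps)
    also have "\<dots> \<le> (J_max / R\<^sub>1 + (C\<^sub>T\<^sub>V + A + (3 / 2 * b + 4 * A * 2 / (c * v * b)) * measure \<nu>star X)) * R"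
      using J_max_nonneg R\<^sub>1 rb(1) by (intro mult_right_mono) auto
    finally show ?thesis .
  qed
  then show ?thesis by (simp add: A_def R_def add.assoc)
qed

end

lemma oracle_calls_eq:
  "oracle_calls K = (\<Sum>k=1..K. k)" and real_oracle_calls_eq: "real (oracle_calls K) = real K * (real K + 1) / 2"
proof -
  show eq: "oracle_calls K = (\<Sum>k=1..K. k)"
    unfolding oracle_calls_def batch_size_def by (intro sum.cong) auto
  have "real (\<Sum>k=1..K. k) = real K * (real K + 1) / 2"
    by (induction K) (auto simp: field_simps)
  then show "real (oracle_calls K) = real K * (real K + 1) / 2" by (simp only: eq)
qed

text \<open>The rate in terms of the number \<open>N\<close> of oracle calls uses \<open>K \<le> N \<le> K\<^sup>2\<close> only.\<close>

lemma rate_le_oracle_rate: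
  assumes "2 \<le> K"
  shows "((ln (real K)) ^ 3 / real K) powr (1 / (2 * (2 + real d)))
    \<le> real (oracle_calls K) powr (- 1 / (4 * (2 + real d)))
      * ln (real (oracle_calls K)) powr (3 / (2 * (2 + real d)))"
proof -
  let ?N = "real (oracle_calls K)" and ?p = "1 / (2 * (2 + real d))"
  have K: "2 \<le> real K" using assms by simp
  have N: "real K \<le> ?N" "?N \<le> real K * real K"
    using mult_mono[OF K order_refl, of "real K"] K by (auto simp: real_oracle_calls_eq field_simps)
  have l: "0 < ln (real K)" using K by simp
  have "((ln (real K)) ^ 3 / real K) powr ?p = ln (real K) powr (3 * ?p) * real K powr (- ?p)"
  proof -
    have "(ln (real K) ^ 3) powr ?p = ln (real K) powr (3 * ?p)"
      using l powr_powr[of "ln (real K)" 3 ?p] by (simp add: powr_numeral)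
    then show ?thesis using l K by (simp add: powr_divide powr_minus_divide)
  qed
  also have "\<dots> \<le> ln ?N powr (3 * ?p) * ?N powr (- ?p / 2)"
  proof (intro mult_mono)
    show "ln (real K) powr (3 * ?p) \<le> ln ?N powr (3 * ?p)"
      using l N K by (intro powr_mono2) auto
    have "real K powr (- p) = (real K * real K) powr (- p / 2)" for p :: real
      using K by (simp add: powr_mult powr_add[symmetric])
    then have "real K powr (- ?p) = (real K * real K) powr (- ?p / 2)" .
    also have "\<dots> \<le> ?N powr (- ?p / 2)" using N K by (intro powr_mono2') auto
    finally show "real K powr (- ?p) \<le> ?N powr (- ?p / 2)" .
  qed auto
  finally show ?thesis by (simp add: mult.commute)
qed

section \<open>The convergence rate\<close>

theorem theorem3p2:
  fixes X :: "'a::euclidean_space set"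
    and \<Phi> :: "('a set \<Rightarrow> real) \<Rightarrow> 'h::{real_inner, polish_space}"
    and y :: 'h
    and \<kappa> c\<^sub>P C\<^sub>P C\<^sub>T\<^sub>V c C a :: real
    and \<nu>star :: "'a measure"
  assumes "compact X" and "convex X" and "X = closure (interior X)"
    and "measure_operator X \<Phi>"
    and "0 < \<kappa>"
    and "problem_assumption X \<Phi> y c\<^sub>P C\<^sub>P"
    and "is_minimizer X \<Phi> y \<kappa> \<nu>star"
    and "0 < c" and "0 < C"
    and "0 < a" and "real DIM('a) / (2 * (2 + real DIM('a))) \<le> a"
  shows "(\<exists>C\<^sub>0>0. \<forall>(\<alpha>::real) (P :: 'w measure) F Fp \<nu> \<nu>p.
      0 < \<alpha> \<longrightarrow> \<alpha> < 1 / (10 * (1 + C\<^sub>T\<^sub>V + C\<^sub>P + \<kappa>) * max 1 C\<^sub>T\<^sub>V) \<longrightarrow>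
      prob_space P \<longrightarrow> interlaced_filtrations P F Fp \<longrightarrow>
      (\<forall>k. random_measure X (F k) (\<nu> k)) \<longrightarrow>
      (\<forall>k. random_measure X (Fp k) (\<nu>p k)) \<longrightarrow>
      hyp_TV X P \<nu> C\<^sub>T\<^sub>V \<longrightarrow>
      hyp_D P F \<nu> \<nu>p (objective X \<Phi> y \<kappa>) (certificate X \<Phi> y \<kappa>) \<alpha> batch_size beta_schedule C \<longrightarrow>
      hyp_birth X P Fp \<nu> \<nu>p (certificate X \<Phi> y \<kappa>) a batch_size (birth_rate \<alpha>) c C \<longrightarrow>
      hyp_smooth1 P Fp \<nu> \<nu>p (objective X \<Phi> y \<kappa>) batch_size (birth_rate \<alpha>) C \<longrightarrow>
      hyp_smooth2 X P \<nu> \<nu>p (certificate X \<Phi> y \<kappa>) (birth_rate \<alpha>) C \<longrightarrow>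
      (\<forall>K. 4 / \<alpha>\<^sup>2 \<le> real K \<longrightarrow>
         prob_space.expectation P (best_gap (objective X \<Phi> y \<kappa>) \<nu> \<nu>star K)
           \<le> C\<^sub>0 * \<alpha> powr (- 1 / 2)
               * ((ln (real K)) ^ 3 / real K) powr (1 / (2 * (2 + real DIM('a))))) \<and>
      (\<lambda>K. prob_space.expectation P (best_gap (objective X \<Phi> y \<kappa>) \<nu> \<nu>star K))
        \<in> O(\<lambda>K. real (oracle_calls K) powr (- 1 / (4 * (2 + real DIM('a))))
              * ln (real (oracle_calls K)) powr (3 / (2 * (2 + real DIM('a)))))) \<and>
    (\<forall>K. oracle_calls K = (\<Sum>k=1..K. k) \<and> real (oracle_calls K) = real K * (real K + 1) / 2)"
proof (intro conjI allI oracle_calls_eq real_oracle_calls_eq)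
  let ?J = "objective X \<Phi> y \<kappa>" and ?J' = "certificate X \<Phi> y \<kappa>"
  let ?rate = "\<lambda>K. ((ln (real K)) ^ 3 / real K) powr (1 / (2 * (2 + real DIM('a))))"
  let ?oracle_rate = "\<lambda>K. real (oracle_calls K) powr (- 1 / (4 * (2 + real DIM('a))))
              * ln (real (oracle_calls K)) powr (3 / (2 * (2 + real DIM('a))))"
  define hyps where "hyps \<alpha> (P :: 'w measure) F Fp \<nu> \<nu>p \<longleftrightarrow> 0 < \<alpha> \<and>
      \<alpha> < 1 / (10 * (1 + C\<^sub>T\<^sub>V + C\<^sub>P + \<kappa>) * max 1 C\<^sub>T\<^sub>V) \<and>
      prob_space P \<and> interlaced_filtrations P F Fp \<and>
      (\<forall>k. random_measure X (F k) (\<nu> k)) \<and>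
      (\<forall>k. random_measure X (Fp k) (\<nu>p k)) \<and>
      hyp_TV X P \<nu> C\<^sub>T\<^sub>V \<and>
      hyp_D P F \<nu> \<nu>p ?J ?J' \<alpha> batch_size beta_schedule C \<and>
      hyp_birth X P Fp \<nu> \<nu>p ?J' a batch_size (birth_rate \<alpha>) c C \<and>
      hyp_smooth1 P Fp \<nu> \<nu>p ?J batch_size (birth_rate \<alpha>) C \<and>
      hyp_smooth2 X P \<nu> \<nu>p ?J' (birth_rate \<alpha>) C" for \<alpha> P F Fp \<nu> \<nu>p
  have star: "\<nu>star \<in> nonneg_measures X" using assms(7) by (simp add: is_minimizer_def)
  have CP: "0 < C\<^sub>P" "norm y \<le> C\<^sub>P" using assms(6) by (auto simp: problem_assumption_def)

  have "\<exists>C\<^sub>0>0. \<forall>\<alpha> P F Fp \<nu> \<nu>p. hyps \<alpha> P F Fp \<nu> \<nu>p \<longrightarrow>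
      (\<forall>K. 4 / \<alpha>\<^sup>2 \<le> real K \<longrightarrow>
        0 \<le> prob_space.expectation P (best_gap ?J \<nu> \<nu>star K) \<and>
        prob_space.expectation P (best_gap ?J \<nu> \<nu>star K) \<le> C\<^sub>0 * \<alpha> powr (- 1 / 2) * ?rate K)"
  proof (cases "X = {}")
    \<comment> \<open>The empty set is the only compact set with empty interior that equals the closure of its
      interior; all measures on it vanish.\<close>
    case True
    have null: "measure M = (\<lambda>B. 0)" if "M \<in> nonneg_measures X" for M
    proof
      fix B
      show "measure M B = 0"
        using that True by (cases "B \<in> sets M") (auto simp: nonneg_measures_def sets_restrict_space measure_notin_sets)
    qed
    have "prob_space.expectation P (best_gap ?J \<nu> \<nu>star K) = 0"
      if h: "hyps \<alpha> P F Fp \<nu> \<nu>p" and K: "4 / \<alpha>\<^sup>2 \<le> real K" for \<alpha> P F Fp \<nu> \<nu>p K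
    proof -
      have "0 < 4 / \<alpha>\<^sup>2" using h by (simp add: hyps_def)
      then have "0 < K" using K by (cases K) auto
      have "best_gap ?J \<nu> \<nu>star K \<omega> = 0" if "\<omega> \<in> space P" for \<omega>
      proof -
        have "\<nu> k \<omega> \<in> nonneg_measures X" for k
          using h that by (auto simp: hyps_def random_measure_def interlaced_filtrations_def subalgebra_def)
        then have "?J (\<nu> k \<omega>) - ?J \<nu>star = 0" for k
          by (simp add: objective_def null star)
        then show ?thesis using \<open>0 < K\<close> by (simp add: best_gap_def image_constant_conv)
      qed
      then have "prob_space.expectation P (best_gap ?J \<nu> \<nu>star K) = prob_space.expectation P (\<lambda>_. 0)"
        by (intro Bochner_Integration.integral_cong) auto
      then show ?thesis by simp
    qed
    then show ?thesis by (intro exI[of _ 1]) auto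
  next
    case False
    then have int: "interior X \<noteq> {}" using assms(3) by (metis closure_empty)
    obtain \<Lambda> where \<Lambda>: "0 < \<Lambda>"
      "\<And>s t. s \<in> X \<Longrightarrow> t \<in> X \<Longrightarrow> norm (feature X \<Phi> s - feature X \<Phi> t) \<le> \<Lambda> * dist s t"
      using feature_lipschitz_of_C2[OF assms(1,2)] assms(6) unfolding problem_assumption_def by metis
    have unit: "norm (feature X \<Phi> t) = 1" if "t \<in> X" for t
      using assms(6) that by (simp add: problem_assumption_def feature_kernel_def norm_eq_1)
    interpret measure_problem X \<Phi> y \<kappa> \<Lambda>
      by unfold_locales (use assms(1,2,4,5) False \<Lambda> unit in auto)
    obtain v D where vol: "0 < v" "0 < D"
      "\<And>x r. x \<in> X \<Longrightarrow> 0 < r \<Longrightarrow> r \<le> D \<Longrightarrow> v * r ^ DIM('a) \<le> measure lborel (cball x r \<inter> X)"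
      using convex_cball_volume[OF assms(1,2) int] by metis
    \<comment> \<open>\<open>L\<close> is a Lipschitz constant of the certificates. The lower bounds on \<open>b\<close> serve, in turn, that
      the radius \<open>b R / (4 L)\<close> is at least \<open>R\<close>, that one step changes the certificate by at most a
      quarter of \<open>b R\<close>, and that births dominate the sampling noise.\<close>
    define L where "L = \<bar>\<Lambda> * (C\<^sub>T\<^sub>V + C\<^sub>P)\<bar> + 1"
    define b where "b = max (4 * L) (max (8 * C) (16 * C * L / (c * v)))"
    define R\<^sub>1 where "R\<^sub>1 = min 1 (4 * L * D / b)"
    define Jm where "Jm = (C\<^sub>P + C\<^sub>T\<^sub>V)\<^sup>2 / 2 + \<kappa> * C\<^sub>T\<^sub>V"
    \<comment> \<open>For \<open>C\<^sub>T\<^sub>V < 0\<close> there is no such process, but \<open>C\<^sub>0\<close> still has to be positive.\<close>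
    define C\<^sub>0 where "C\<^sub>0 = max 1 (Jm / R\<^sub>1 + C\<^sub>T\<^sub>V + 4 * (Jm + 5 * C)
        + (3 / 2 * b + 4 * (4 * (Jm + 5 * C)) * 2 / (c * v * b)) * measure \<nu>star X)"
    have L: "0 < L" "\<Lambda> * (C\<^sub>T\<^sub>V + C\<^sub>P) \<le> L" by (auto simp: L_def)
    have b: "4 * L \<le> b" "8 * C \<le> b" "16 * C * L / (c * v) \<le> b" by (auto simp: b_def)
    have R\<^sub>1: "0 < R\<^sub>1" "R\<^sub>1 \<le> 1" "R\<^sub>1 \<le> 4 * L * D / b"
      using L b vol(2) by (auto simp: R\<^sub>1_def)
    show ?thesis
    proof (intro exI[of _ C\<^sub>0] conjI allI impI)
      fix \<alpha> P F Fp \<nu> \<nu>p K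
      assume h: "hyps \<alpha> P F Fp \<nu> \<nu>p" and K: "4 / \<alpha>\<^sup>2 \<le> real K"
      interpret prob_space P using h by (simp add: hyps_def)
      have "\<nu> 0 \<omega> \<in> nonneg_measures X" if "\<omega> \<in> space P" for \<omega>
        using h that by (auto simp: hyps_def random_measure_def interlaced_filtrations_def subalgebra_def)
      then have CTV: "0 \<le> C\<^sub>T\<^sub>V"
        using hyp_TV_bound_nonneg[OF prob_space_axioms, of X \<nu> C\<^sub>T\<^sub>V] h by (simp add: hyps_def)
      have "1 * 1 \<le> (10 * (1 + C\<^sub>T\<^sub>V + C\<^sub>P + \<kappa>)) * max 1 C\<^sub>T\<^sub>V"
        using CTV CP assms(5) by (intro mult_mono) auto
      then have "1 / (10 * (1 + C\<^sub>T\<^sub>V + C\<^sub>P + \<kappa>) * max 1 C\<^sub>T\<^sub>V) \<le> 1" by simp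
      then have \<alpha>: "0 < \<alpha>" "\<alpha> \<le> 1" using h by (auto simp: hyps_def)
      interpret stochastic_descent X \<Phi> y \<kappa> \<Lambda> P F Fp \<nu> \<nu>p \<alpha> c C a C\<^sub>P C\<^sub>T\<^sub>V
        by unfold_locales (use h \<alpha> CP assms(8,9) in \<open>auto simp: hyps_def\<close>)
      have "0 < 4 / \<alpha>\<^sup>2" using \<alpha> by simp
      then have K1: "1 \<le> K" using K by (cases K) auto
      show "0 \<le> expectation (best_gap ?J \<nu> \<nu>star K)"
        by (rule expectation_best_gap_nonneg[OF K1 assms(7)])
      have "expectation (best_gap ?J \<nu> \<nu>star K) \<le> (Jm / R\<^sub>1 + C\<^sub>T\<^sub>V + 4 * (Jm + 5 * C)
        + (3 / 2 * b + 4 * (4 * (Jm + 5 * C)) * 2 / (c * v * b)) * measure \<nu>star X) * rate DIM('a) \<alpha> K"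
        using expectation_best_gap_rate[OF vol assms(11) L b R\<^sub>1 star K] unfolding J_max_def Jm_def .
      also have "\<dots> \<le> C\<^sub>0 * rate DIM('a) \<alpha> K"
        by (intro mult_right_mono) (auto simp: C\<^sub>0_def rate_def)
      finally show "expectation (best_gap ?J \<nu> \<nu>star K) \<le> C\<^sub>0 * \<alpha> powr (- 1 / 2) * ?rate K"
        by (simp only: rate_def mult.assoc)
    qed (simp add: C\<^sub>0_def)
  qed
  then obtain C\<^sub>0 where C\<^sub>0: "0 < C\<^sub>0" and
    "\<forall>\<alpha> P F Fp \<nu> \<nu>p. hyps \<alpha> P F Fp \<nu> \<nu>p \<longrightarrow> (\<forall>K. 4 / \<alpha>\<^sup>2 \<le> real K \<longrightarrow>
        0 \<le> prob_space.expectation P (best_gap ?J \<nu> \<nu>star K) \<and>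
        prob_space.expectation P (best_gap ?J \<nu> \<nu>star K) \<le> C\<^sub>0 * \<alpha> powr (- 1 / 2) * ?rate K)"
    by (elim exE conjE)
  note gap = this(2)[rule_format]
  have bigo: "(\<lambda>K. prob_space.expectation P (best_gap ?J \<nu> \<nu>star K)) \<in> O(?oracle_rate)"
    if h: "hyps \<alpha> P F Fp \<nu> \<nu>p" for \<alpha> P F Fp \<nu> \<nu>p
  proof (rule bigoI[where c = "C\<^sub>0 * \<alpha> powr (- 1 / 2)"])
    show "\<forall>\<^sub>F K in at_top. norm (prob_space.expectation P (best_gap ?J \<nu> \<nu>star K))
        \<le> C\<^sub>0 * \<alpha> powr (- 1 / 2) * norm (?oracle_rate K)"
      using eventually_ge_at_top[of "max 2 (nat \<lceil>4 / \<alpha>\<^sup>2\<rceil>)"]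
    proof eventually_elim
      case (elim K)
      then have K: "2 \<le> K" "4 / \<alpha>\<^sup>2 \<le> real K" by linarith+
      have "C\<^sub>0 * \<alpha> powr (- 1 / 2) * ?rate K \<le> C\<^sub>0 * \<alpha> powr (- 1 / 2) * ?oracle_rate K"
        using rate_le_oracle_rate[OF K(1)] C\<^sub>0 by (intro mult_left_mono) auto
      then show ?case using gap[OF h K(2)] by auto
    qed
  qed
  show "\<exists>C\<^sub>0>0. \<forall>(\<alpha>::real) (P :: 'w measure) F Fp \<nu> \<nu>p.
      0 < \<alpha> \<longrightarrow> \<alpha> < 1 / (10 * (1 + C\<^sub>T\<^sub>V + C\<^sub>P + \<kappa>) * max 1 C\<^sub>T\<^sub>V) \<longrightarrow>
      prob_space P \<longrightarrow> interlaced_filtrations P F Fp \<longrightarrow>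
      (\<forall>k. random_measure X (F k) (\<nu> k)) \<longrightarrow>
      (\<forall>k. random_measure X (Fp k) (\<nu>p k)) \<longrightarrow>
      hyp_TV X P \<nu> C\<^sub>T\<^sub>V \<longrightarrow>
      hyp_D P F \<nu> \<nu>p ?J ?J' \<alpha> batch_size beta_schedule C \<longrightarrow>
      hyp_birth X P Fp \<nu> \<nu>p ?J' a batch_size (birth_rate \<alpha>) c C \<longrightarrow>
      hyp_smooth1 P Fp \<nu> \<nu>p ?J batch_size (birth_rate \<alpha>) C \<longrightarrow>
      hyp_smooth2 X P \<nu> \<nu>p ?J' (birth_rate \<alpha>) C \<longrightarrow>
      (\<forall>K. 4 / \<alpha>\<^sup>2 \<le> real K \<longrightarrow>
         prob_space.expectation P (best_gap ?J \<nu> \<nu>star K) \<le> C\<^sub>0 * \<alpha> powr (- 1 / 2) * ?rate K) \<and>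
      (\<lambda>K. prob_space.expectation P (best_gap ?J \<nu> \<nu>star K)) \<in> O(?oracle_rate)"
  proof (intro exI[of _ C\<^sub>0] conjI[OF C\<^sub>0] allI impI)
    fix \<alpha> and P :: "'w measure" and F Fp \<nu> \<nu>p
    assume "0 < \<alpha>" "\<alpha> < 1 / (10 * (1 + C\<^sub>T\<^sub>V + C\<^sub>P + \<kappa>) * max 1 C\<^sub>T\<^sub>V)" "prob_space P"
      "interlaced_filtrations P F Fp" "\<forall>k. random_measure X (F k) (\<nu> k)"
      "\<forall>k. random_measure X (Fp k) (\<nu>p k)" "hyp_TV X P \<nu> C\<^sub>T\<^sub>V"
      "hyp_D P F \<nu> \<nu>p ?J ?J' \<alpha> batch_size beta_schedule C"
      "hyp_birth X P Fp \<nu> \<nu>p ?J' a batch_size (birth_rate \<alpha>) c C"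
      "hyp_smooth1 P Fp \<nu> \<nu>p ?J batch_size (birth_rate \<alpha>) C"
      "hyp_smooth2 X P \<nu> \<nu>p ?J' (birth_rate \<alpha>) C"
    then have "hyps \<alpha> P F Fp \<nu> \<nu>p" by (simp add: hyps_def)
    then show "(\<forall>K. 4 / \<alpha>\<^sup>2 \<le> real K \<longrightarrow>
         prob_space.expectation P (best_gap ?J \<nu> \<nu>star K) \<le> C\<^sub>0 * \<alpha> powr (- 1 / 2) * ?rate K) \<and>
      (\<lambda>K. prob_space.expectation P (best_gap ?J \<nu> \<nu>star K)) \<in> O(?oracle_rate)"
      using gap bigo by blast
  qed
qed

end
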